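(* For every constant $c>0$ there exists an algorithm that, given an integer $n\ge16$ and an integer $k\in[1,n]$, outputs $k$ integers with failure probability at most $1/n^c$; conditioned on success, the output is distributed uniformly over sets of $k$ distinct primes in the range $[n,n^2]$. The algorithm runs in $O(k\log^{O(1)}n)$ bit operations and uses $O(k\log n)$ bits of space. *)

theory Defs
  imports
    "HOL-Probability.Probability"
    "HOL-Library.Log_Nat"
    "HOL-Computational_Algebra.Primes"
begin

text \<open>
  The machine model is the random access machine with fair coins under the logarithmic cost
  criterion: every instruction is charged the number of bit operations needed to carry it out on
  binary operands, so that the accumulated cost of a run is its number of bit operations.
  Programs are structured (sequence, branch, loop), and registers are indexed by and contain
  natural numbers. Only finitely many registers are ever nonzero.
\<close>

datatype instr =
    Const nat nat       \<comment> \<open>\<open>Const r a\<close>: \<open>M[r] := a\<close>\<close>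
  | Copy nat nat        \<comment> \<open>\<open>Copy r s\<close>: \<open>M[r] := M[s]\<close>\<close>
  | Load nat nat        \<comment> \<open>\<open>Load r s\<close>: \<open>M[r] := M[M[s]]\<close>\<close>
  | Store nat nat       \<comment> \<open>\<open>Store r s\<close>: \<open>M[M[r]] := M[s]\<close>\<close>
  | Add nat nat nat     \<comment> \<open>\<open>Add r s t\<close>: \<open>M[r] := M[s] + M[t]\<close>; likewise the next four\<close>
  | Sub nat nat nat     \<comment> \<open>truncated subtraction\<close>
  | Mul nat nat nat
  | Div nat nat nat
  | Mod nat nat nat
  | Coin nat            \<comment> \<open>\<open>Coin r\<close>: \<open>M[r]\<close> becomes a fresh uniformly random bit\<close>
  | Emit nat            \<comment> \<open>\<open>Emit r\<close>: append \<open>M[r]\<close> to the output\<close>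

datatype prog =
    Instr instr
  | Seq prog prog
  | If_Nonzero nat prog prog
  | While_Nonzero nat prog

record ram_state =
  mem :: "nat \<Rightarrow> nat"
  outp :: "nat list"
  bit_ops :: nat
  peak_space :: nat

abbreviation bits :: "nat \<Rightarrow> nat" where
  "bits \<equiv> floorlog 2"

text \<open>
  Linear charge for moves, addition and subtraction (an indirect access also pays for the
  address), and the schoolbook bound, proportional to the product of the operand lengths, for
  multiplication and division.
\<close>

fun instr_cost :: "(nat \<Rightarrow> nat) \<Rightarrow> instr \<Rightarrow> nat" where
  "instr_cost M (Const r a) = 1 + bits a"
| "instr_cost M (Copy r s) = 1 + bits (M s)"
| "instr_cost M (Load r s) = 1 + bits (M s) + bits (M (M s))"
| "instr_cost M (Store r s) = 1 + bits (M r) + bits (M s)"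
| "instr_cost M (Add r s t) = 1 + bits (M s) + bits (M t)"
| "instr_cost M (Sub r s t) = 1 + bits (M s) + bits (M t)"
| "instr_cost M (Mul r s t) = (1 + bits (M s)) * (1 + bits (M t))"
| "instr_cost M (Div r s t) = (1 + bits (M s)) * (1 + bits (M t))"
| "instr_cost M (Mod r s t) = (1 + bits (M s)) * (1 + bits (M t))"
| "instr_cost M (Coin r) = 1"
| "instr_cost M (Emit r) = 1 + bits (M r)"

fun instr_mem :: "instr \<Rightarrow> (nat \<Rightarrow> nat) \<Rightarrow> (nat \<Rightarrow> nat) pmf" where
  "instr_mem (Const r a) M = return_pmf (M(r := a))"
| "instr_mem (Copy r s) M = return_pmf (M(r := M s))"
| "instr_mem (Load r s) M = return_pmf (M(r := M (M s)))"
| "instr_mem (Store r s) M = return_pmf (M(M r := M s))"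
| "instr_mem (Add r s t) M = return_pmf (M(r := M s + M t))"
| "instr_mem (Sub r s t) M = return_pmf (M(r := M s - M t))"
| "instr_mem (Mul r s t) M = return_pmf (M(r := M s * M t))"
| "instr_mem (Div r s t) M = return_pmf (M(r := M s div M t))"
| "instr_mem (Mod r s t) M = return_pmf (M(r := M s mod M t))"
| "instr_mem (Coin r) M = map_pmf (\<lambda>b. M(r := of_bool b)) (bernoulli_pmf (1/2))"
| "instr_mem (Emit r) M = return_pmf M"

fun instr_out :: "instr \<Rightarrow> (nat \<Rightarrow> nat) \<Rightarrow> nat list" where
  "instr_out (Emit r) M = [M r]"
| "instr_out _ M = []"

text \<open>
  A register in use is charged for its address as well as for its contents, which is what it
  takes to store it in a dictionary; hence sparse addressing does not hide any information.
  The output produced so far is charged, too.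
\<close>

definition space_in_use :: "(nat \<Rightarrow> nat) \<Rightarrow> nat list \<Rightarrow> nat" where
  "space_in_use M xs =
     (\<Sum>r | M r \<noteq> 0. bits r + bits (M r)) + (\<Sum>x\<leftarrow>xs. 1 + bits x)"

definition exec_instr :: "instr \<Rightarrow> ram_state \<Rightarrow> ram_state spmf" where
  "exec_instr i s =
     map_spmf
       (\<lambda>M'. let xs' = outp s @ instr_out i (mem s) in
          \<lparr>mem = M', outp = xs',
           bit_ops = bit_ops s + instr_cost (mem s) i,
           peak_space = max (peak_space s) (space_in_use M' xs')\<rparr>)
       (spmf_of_pmf (instr_mem i (mem s)))"

definition charge_test :: "nat \<Rightarrow> ram_state \<Rightarrow> ram_state" where
  "charge_test r s = s\<lparr>bit_ops := bit_ops s + 1 + bits (mem s r)\<rparr>"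

text \<open>
  The least fixed point in the order on subprobability distributions: nontermination shows up as
  missing probability mass.
\<close>

partial_function (spmf) while_spmf ::
  "('s \<Rightarrow> bool) \<Rightarrow> ('s \<Rightarrow> 's spmf) \<Rightarrow> 's \<Rightarrow> 's spmf" where
  "while_spmf guard body s =
     (if guard s then bind_spmf (body s) (while_spmf guard body) else return_spmf s)"

primrec exec :: "prog \<Rightarrow> ram_state \<Rightarrow> ram_state spmf" where
  "exec (Instr i) = exec_instr i"
| "exec (Seq p q) = (\<lambda>s. bind_spmf (exec p s) (exec q))"
| "exec (If_Nonzero r p q) =
     (\<lambda>s. if mem s r \<noteq> 0 then exec p (charge_test r s) else exec q (charge_test r s))"
| "exec (While_Nonzero r p) =
     (\<lambda>s. map_spmf (charge_test r)
            (while_spmf (\<lambda>s. mem s r \<noteq> 0) (\<lambda>s. exec p (charge_test r s)) s))"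

definition input_mem :: "nat \<Rightarrow> nat \<Rightarrow> nat \<Rightarrow> nat" where
  "input_mem n k = (\<lambda>_. 0)(0 := n, 1 := k)"

definition run :: "prog \<Rightarrow> nat \<Rightarrow> nat \<Rightarrow> ram_state spmf" where
  "run P n k =
     exec P \<lparr>mem = input_mem n k, outp = [], bit_ops = 0,
             peak_space = space_in_use (input_mem n k) []\<rparr>"

definition prime_sets :: "nat \<Rightarrow> nat \<Rightarrow> nat set set" where
  "prime_sets n k = {S. S \<subseteq> {p. prime p \<and> n \<le> p \<and> p \<le> n\<^sup>2} \<and> card S = k}"

definition success :: "nat \<Rightarrow> nat \<Rightarrow> ram_state set" where
  "success n k = {s. length (outp s) = k \<and> set (outp s) \<in> prime_sets n k}"

end

theory Submission
  imports Defs "HOL-Number_Theory.Residues"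
begin

text \<open>
  Let \<open>L\<close> be the bit length of \<open>n\<close>. For each of the \<open>k\<close> primes wanted, make \<open>O(L\<^sup>2)\<close> attempts: draw a
  number \<open>x\<close> of \<open>2 L + 1\<close> random bits, reject it if it is outside \<open>[n, n\<^sup>2]\<close> or was output before, and
  output it if it passes \<open>O(L)\<close> rounds of the Miller-Rabin test. The numbers output so far are
  remembered by setting the register whose address is \<open>x\<close>, so that a lookup takes \<open>O(L)\<close> bit
  operations and the memory in use stays within \<open>O(k L)\<close> bits.

  By Chebyshev's lower bound on the number of primes, an attempt finds a new prime with probability
  at least \<open>1 / (512 L)\<close>, and a composite number passes a round with probability at most \<open>3/4\<close>; a
  union bound over slots and attempts bounds the failure probability. As primes always pass
  the test, every list of \<open>k\<close> distinct primes in the range has the same probability of being output,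
  which gives uniformity exactly.
\<close>

section \<open>The number of primes in the range\<close>

text \<open>Uniformity has to be exact although the test errs. As long as a run is successful, only
  primes have entered the dictionary, so it never excludes a composite: the chance that a try
  accepts some composite is the same in all slots, and the weight of a new prime depends only on how
  many were found before. A slot without a find adds nothing, which leaves the list too short to be
  a success; hence every loop has a fixed limit, and the resource bounds hold for every run, not
  just on average.

  Up to \<open>n - 1\<close> primes may be taken when a slot starts, so the prime count needs a
  margin of about \<open>n\<close> over what one attempt requires.

  The base of a round is a random word reduced modulo the candidate, which is not uniform. At most
  half of the residues pass, 0 included; the bias of the reduction turns this into
  \<open>3/4\<close>.

  Program and probability are kept apart: the machine is coupled once with an abstract distribution
  made of \<open>iter_pmf\<close>, \<open>slot_pmf\<close> and \<open>append_pmf\<close>, and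
  failure and uniformity are computed on that alone.\<close>

text \<open>Nair's route to Chebyshev's bound: a common multiple of \<open>1..n\<close> is forced to
  be large by having \<open>m * (r choose m)\<close> as a divisor. The row \<open>r\<close> varies
  in the induction on the column, because an entry is obtained from the previous column in rows
  \<open>r\<close> and \<open>r - 1\<close>.\<close>

lemma mult_binomial_dvd:
  fixes D n r j :: nat
  assumes D: "\<And>i. 1 \<le> i \<Longrightarrow> i \<le> n \<Longrightarrow> i dvd D"
  shows "Suc j \<le> r \<Longrightarrow> r \<le> n \<Longrightarrow> Suc j * (r choose Suc j) dvd D"
proof (induction j arbitrary: r)
  case 0
  then show ?case using D[of r] by simp
next
  case (Suc j)
  obtain q where r: "r = Suc q" using Suc.prems by (cases r) auto
  have "Suc j * (r choose Suc j) dvd D" "Suc j * (q choose Suc j) dvd D"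
    using Suc.IH[of r] Suc.IH[of q] Suc.prems r by auto
  then obtain u v where u: "D = Suc j * (r choose Suc j) * u" and v: "D = Suc j * (q choose Suc j) * v"
    unfolding dvd_def by blast
  define a b where "a = q choose j" and "b = q choose Suc j"
  define e where "e = q choose Suc (Suc j)"
  have rb: "r choose Suc j = a + b" "r choose Suc (Suc j) = b + e"
    by (simp_all add: r a_def b_def e_def)
  have h1: "(j + 1) * (a + b) = (q + 1) * a"
    using Suc_times_binomial[of j q] rb r by (simp add: a_def)
  have h2: "(j + 2) * (b + e) = (q + 1) * b"
    using Suc_times_binomial[of "Suc j" q] rb r by (simp add: b_def)
  have uD: "D = (q + 1) * a * u" using u h1 rb by simp
  have vD: "D = (j + 1) * b * v" using v by (simp add: b_def)
  have apos: "a > 0" using Suc.prems r by (simp add: a_def)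
  have bpos: "b > 0" using Suc.prems r by (simp add: b_def)
  text \<open>Leibniz's harmonic triangle: the reciprocal of the claimed divisor is the difference of
    the reciprocals of the two given ones.\<close>
  have "int D = (int q + 1) * int b * (int v - int u)"
  proof -
    have h1': "(int j + 1) * (int a + int b) = (int q + 1) * int a"
      using arg_cong[OF h1, of int] by (simp only: of_nat_mult of_nat_add of_nat_1)
    have uD': "int D = (int q + 1) * int a * int u" using arg_cong[OF uD, of int] by (simp only: of_nat_mult of_nat_add of_nat_1)
    have vD': "int D = (int j + 1) * int b * int v" using arg_cong[OF vD, of int] by (simp only: of_nat_mult of_nat_add of_nat_1)
    have "int a * ((int q + 1) * int b * (int v - int u)) 
      = (int q + 1) * int a * int b * int v - int b * int D"
      using uD' by (simp add: algebra_simps)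
    also have "\<dots> = (int a + int b) * ((int j + 1) * int b * int v) - int b * int D"
      using h1' by (metis (no_types, lifting) mult.assoc mult.commute)
    also have "\<dots> = int a * int D" using vD' by (simp add: algebra_simps)
    finally show ?thesis using apos by simp
  qed
  then have "(int q + 1) * int b dvd int D" by (metis dvd_triv_left)
  then have "int ((q + 1) * b) dvd int D" by (simp add: algebra_simps)
  then have "(q + 1) * b dvd D" by (subst (asm) of_nat_dvd_iff)
  moreover have "Suc (Suc j) * (r choose Suc (Suc j)) = (q + 1) * b" using h2 rb by simp
  ultimately show ?case by (simp only:)
qed

text \<open>\<open>GREATEST\<close> has its expected properties for a bounded predicate; this is the
  bound on the exponents.\<close>

lemma exponent_le_of_power_le:
  fixes p e N :: nat
  assumes "2 \<le> p" "p ^ e \<le> N"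
  shows "e \<le> N"
proof -
  have "e < 2 ^ e" by (rule less_exp)
  also have "\<dots> \<le> p ^ e" using assms by (intro power_mono) auto
  finally show ?thesis using assms by simp
qed

text \<open>The product is the least common multiple of \<open>1..N\<close>, written so that each
  factor is visibly at most \<open>N\<close>. Divisibility is checked prime by prime: the power of
  \<open>p\<close> in \<open>i\<close> is itself at most \<open>N\<close>, so its exponent does not
  exceed the greatest one.\<close>

lemma prime_power_product_dvd:
  fixes N i :: nat
  assumes "1 \<le> i" "i \<le> N"
  shows "i dvd (\<Prod>p | prime p \<and> p \<le> N. p ^ (GREATEST e. p ^ e \<le> N))"
    (is "_ dvd ?D")
proof -
  have fin: "finite {p::nat. prime p \<and> p \<le> N}" by simp
  have D0: "?D \<noteq> 0" by (auto simp: fin)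
  have "multiplicity p i \<le> multiplicity p ?D" if p: "prime p" for p
  proof (cases "p \<le> N")
    case False
    then have "\<not> p dvd i" using assms by (auto dest!: dvd_imp_le)
    then show ?thesis by (simp add: not_dvd_imp_multiplicity_0)
  next
    case True
    have "p ^ multiplicity p i \<le> N"
      using assms by (meson dvd_imp_le le_trans multiplicity_dvd less_le_trans zero_less_one)
    moreover have "e \<le> N" if "p ^ e \<le> N" for e
      using that p exponent_le_of_power_le prime_ge_2_nat by blast
    ultimately have "multiplicity p i \<le> (GREATEST e. p ^ e \<le> N)"
      by (rule Greatest_le_nat[where P = "\<lambda>e. p ^ e \<le> N" and b = N]) blast
    moreover have "p ^ (GREATEST e. p ^ e \<le> N) dvd ?D"
      using True p by (intro dvd_prodI) auto
    then have "(GREATEST e. p ^ e \<le> N) \<le> multiplicity p ?D"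
      using D0 p by (intro multiplicity_geI) (auto simp: not_prime_unit)
    ultimately show ?thesis by simp
  qed
  then show ?thesis using assms D0 by (intro multiplicity_le_imp_dvd) auto
qed

text \<open>The least common multiple is squeezed: the divisor \<open>h * (2 h choose h)\<close>
  forces it above \<open>2 ^ (2 h - 1)\<close>, the factor \<open>h\<close> making up for the loss
  in the estimate \<open>4 ^ h / (2 h)\<close>, while each of its prime powers contributes at most
  \<open>N\<close>.\<close>

lemma prime_count_lower:
  fixes N :: nat
  assumes "2 \<le> N"
  shows "2 ^ (N - 2) \<le> N ^ card {p. prime p \<and> p \<le> N}"
proof -
  define D where "D = (\<Prod>p | prime p \<and> p \<le> N. p ^ (GREATEST e. p ^ e \<le> N))"
  define h where "h = N div 2"
  \<comment> \<open>For odd \<open>N\<close> the halving loses one unit, hence \<open>N - 2\<close>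
    in the exponent.\<close>
  have h: "1 \<le> h" "2 * h \<le> N" "N - 2 \<le> 2 * h - 1" using assms by (auto simp: h_def)
  have "Suc (h - 1) * ((2 * h) choose Suc (h - 1)) dvd D"
    by (rule mult_binomial_dvd[of N]) (use h prime_power_product_dvd in \<open>auto simp: D_def\<close>)
  then have "h * ((2 * h) choose h) dvd D" using h by simp
  moreover have "D > 0" by (auto simp: D_def intro!: prod_pos dest: prime_gt_0_nat)
  ultimately have 1: "h * ((2 * h) choose h) \<le> D" by (auto dest: dvd_imp_le)
  have "(2::real) * 2 ^ (2 * h - 1) = 2 ^ (2 * h)"
    using h by (subst power_Suc[symmetric]) simp
  then have "real (2 ^ (2 * h - 1)) = 4 ^ h / 2" by (simp add: power_mult)
  also have "\<dots> = real h * (4 ^ h / (2 * real h))" using h by simp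
  also have "\<dots> \<le> real h * real ((2 * h) choose h)"
    using h by (intro mult_left_mono central_binomial_lower_bound) auto
  finally have "2 ^ (2 * h - 1) \<le> h * ((2 * h) choose h)"
    by (metis of_nat_le_iff of_nat_mult)
  moreover have "(2::nat) ^ (N - 2) \<le> 2 ^ (2 * h - 1)" using h by (intro power_increasing) auto
  ultimately have 2: "2 ^ (N - 2) \<le> D" using 1 by linarith
  have "D \<le> (\<Prod>p | prime p \<and> p \<le> N. N)"
    unfolding D_def
  proof (intro prod_mono conjI)
    fix p assume p: "p \<in> {p. prime p \<and> p \<le> N}"
    show "p ^ (GREATEST e. p ^ e \<le> N) \<le> N"
    proof (rule GreatestI_nat[where P = "\<lambda>e. p ^ e \<le> N" and b = N and k = 0])
      show "e \<le> N" if "p ^ e \<le> N" for e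
        using that p exponent_le_of_power_le prime_ge_2_nat by blast
    qed (use assms in auto)
  qed auto
  then show ?thesis using 2 by simp
qed

text \<open>The tangent of \<open>log 2\<close> at 16.\<close>
lemma log2_le_tangent:
  fixes x :: real
  assumes "16 \<le> x"
  shows "log 2 x \<le> 5 / 2 + 3 * x / 32"
proof -
  have "ln (x / 16) \<le> x / 16 - 1" using assms by (intro ln_le_minus_one) auto
  \<comment> \<open>\<open>ln 2 \<ge> 2/3\<close> rounds the slope \<open>1 / (16 ln 2)\<close> up
    to \<open>3/32\<close>; the value 4 at 16 stays exact.\<close>
  also have "\<dots> \<le> (x / 16 - 1) * (3 / 2 * ln 2)"
    using assms ln2_ge_two_thirds mult_left_mono[of 1 "3 / 2 * ln 2" "x / 16 - 1"] by simp
  finally have "log 2 (x / 16) \<le> (x / 16 - 1) * (3 / 2)"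
    by (simp add: log_def field_simps)
  moreover have "log 2 (x / 16) = log 2 x - 4"
  proof -
    have "log 2 (16::real) = log 2 (2 ^ 4)" by simp
    also have "\<dots> = 4" by (subst log_nat_power) auto
    finally show ?thesis using assms by (simp add: log_divide)
  qed
  ultimately show ?thesis by (simp add: field_simps)
qed

text \<open>The summand \<open>real n\<close> is a reserve for the primes that earlier slots use up.
  Chebyshev's bound at \<open>n\<^sup>2\<close> gives about \<open>n\<^sup>2 / (2 log n)\<close>
  primes; taking away the primes below \<open>n\<close> and the reserve leaves enough for the
  generous constant 64.\<close>

lemma primes_between_lower:
  fixes n :: nat
  assumes n: "16 \<le> n"
  shows "real n + real (n\<^sup>2) / (64 * log 2 n) \<le> real (card {p. prime p \<and> n \<le> p \<and> p \<le> n\<^sup>2}) + 1"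
proof -
  define l where "l = log 2 (real n)"
  define P where "P = card {p. prime p \<and> p \<le> n\<^sup>2}"
  define Q where "Q = card {p. prime p \<and> n \<le> p \<and> p \<le> n\<^sup>2}"
  have l4: "4 \<le> l"
  proof -
    have "log 2 (2 ^ 4) \<le> l" unfolding l_def using n by (intro log_mono) auto
    then show ?thesis by (subst (asm) log_nat_power) auto
  qed
  have nn: "n \<le> n\<^sup>2" using n by (simp add: power2_eq_square)
  have "2 \<le> n\<^sup>2" using n nn by linarith
  from prime_count_lower[OF this] have "real (2 ^ (n\<^sup>2 - 2)) \<le> real ((n\<^sup>2) ^ P)"
    unfolding P_def by (subst of_nat_le_iff)
  then have "log 2 (2 ^ (n\<^sup>2 - 2)) \<le> log 2 ((real n)^ (2 * P))"
    by (intro log_mono) (simp_all add: power_mult)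
  then have "real (n\<^sup>2 - 2) \<le> real (2 * P) * l"
    using n by (simp add: log_nat_power l_def)
  then have 1: "real n ^ 2 - 2 \<le> 2 * real P * l" using \<open>2 \<le> n\<^sup>2\<close> by (simp add: of_nat_diff)
  have "{p. prime p \<and> p \<le> n\<^sup>2} \<subseteq> {p. prime p \<and> n \<le> p \<and> p \<le> n\<^sup>2} \<union> {2..<n}"
    by (auto dest: prime_ge_2_nat)
  then have "P \<le> card ({p. prime p \<and> n \<le> p \<and> p \<le> n\<^sup>2} \<union> {2..<n})"
    unfolding P_def by (intro card_mono) auto
  also have "\<dots> \<le> Q + card {2..<n}" unfolding Q_def by (rule card_Un_le)
  finally have "real P \<le> real Q + real n - 2" using n by simp
  then have "2 * real P * l \<le> 2 * (real Q + real n - 2) * l" using l4 by (intro mult_right_mono) auto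
  with 1 have 2: "real n ^ 2 - 2 \<le> 2 * (real Q + real n - 2) * l" by simp
  have "l \<le> 5 / 2 + 3 * real n / 32" unfolding l_def using n by (intro log2_le_tangent) auto
  then have "4 * real n * l \<le> 4 * real n * (5 / 2 + 3 * real n / 32)" by (intro mult_left_mono) auto
  then have 3: "4 * real n * l \<le> 10 * real n + 3 / 8 * real n ^ 2" by (simp add: power2_eq_square algebra_simps)
  \<comment> \<open>The coefficient \<open>19/32\<close> is what remains of 1 after
    \<open>1/32\<close> for the claim and \<open>3/8\<close> from the previous estimate. The
    constant 8 makes 16 a root; it is covered by \<open>6 l - 2\<close>, as
    \<open>l \<ge> 4\<close>.\<close>
  have "0 \<le> (real n - 16) * (19/32 * real n - 1/2)" using n by (intro mult_nonneg_nonneg) auto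
  also have "\<dots> = 19/32 * real n ^ 2 - 10 * real n + 8" by (simp add: power2_eq_square field_simps)
  finally have 4: "10 * real n \<le> 19/32 * real n ^ 2 + 8" by simp
  have "2 * l * (real n + real n ^ 2 / (64 * l)) = 2 * l * real n + real n ^ 2 / 32"
    using l4 by (simp add: field_simps)
  also have "\<dots> \<le> 2 * l * (real Q + 1)"
    using 2 3 4 l4 by (simp add: algebra_simps)
  finally have "real n + real n ^ 2 / (64 * l) \<le> real Q + 1" using l4 by simp
  then show ?thesis by (simp add: Q_def l_def)
qed

section \<open>The Miller-Rabin test\<close>

text \<open>The usual test splits \<open>N - 1\<close> into a power of two and an odd part. Here
  every \<open>(N - 1) div 2 ^ Suc j\<close> is inspected: these are exactly the exponents that
  left-to-right exponentiation runs through, so no splitting has to be computed. The condition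
  implies the usual one, and primes still satisfy it because 1 has only two square roots modulo a
  prime.\<close>

definition mr_pass :: "nat \<Rightarrow> nat \<Rightarrow> bool" where
  "mr_pass N a \<longleftrightarrow> [int a ^ (N - 1) = 1] (mod int N) \<and>
     (\<forall>j. [(int a ^ ((N - 1) div 2 ^ Suc j))\<^sup>2 = 1] (mod int N) \<longrightarrow>
        [int a ^ ((N - 1) div 2 ^ Suc j) = 1] (mod int N) \<or>
        [int a ^ ((N - 1) div 2 ^ Suc j) = - 1] (mod int N))"

lemma mr_pass_prime:
  assumes "prime N" and "\<not> N dvd a"
  shows "mr_pass N a"
proof -
  have "[a ^ (N - 1) = 1] (mod N)" using assms by (rule fermat_theorem)
  then have "[int a ^ (N - 1) = 1] (mod int N)"
    by (metis cong_int_iff of_nat_1 of_nat_power)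
  moreover have "[z = 1] (mod int N) \<or> [z = - 1] (mod int N)" if "[z\<^sup>2 = 1] (mod int N)" for z
  proof -
    have "int N dvd (z - 1) * (z + 1)"
      using that by (simp add: cong_iff_dvd_diff power2_eq_square algebra_simps)
    moreover have "prime (int N)" using assms by simp
    ultimately show ?thesis by (auto simp: cong_iff_dvd_diff prime_dvd_mult_iff)
  qed
  ultimately show ?thesis unfolding mr_pass_def by blast
qed

lemma mr_pass_1: "mr_pass N 1"
  by (simp add: mr_pass_def)

lemma coprime_of_power_cong_unit:
  fixes a :: int and N :: nat
  assumes "[a ^ e = 1] (mod int N)" and "0 < e"
  shows "coprime a (int N)"
proof -
  have "[a * a ^ (e - 1) = 1] (mod int N)" using assms by (simp flip: power_Suc)
  then show ?thesis using coprime_iff_invertible_int by auto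
qed

text \<open>\<open>A\<close> and its translate by the unit \<open>w\<close> are disjoint, equally
  large, and consist of units, so both avoid the nonunit \<open>p\<close>. Having
  \<open>N - 2\<close> instead of \<open>N - 1\<close> pays for counting the base 0 as a pass later
  on.\<close>

lemma mult_notin_imp_card_le:
  fixes N p :: nat and w :: int
  assumes A: "A \<subseteq> {1..<N}" and cop: "\<And>a. a \<in> A \<Longrightarrow> coprime (int a) (int N)"
    and w: "coprime w (int N)" and notin: "\<And>a. a \<in> A \<Longrightarrow> nat (w * int a mod int N) \<notin> A"
    and p: "p dvd N" "1 < p" "p < N"
  shows "2 * card A \<le> N - 2"
proof -
  define f where "f = (\<lambda>a. nat (w * int a mod int N))"
  have N: "0 < N" using p by simp
  have fin: "finite A" using A finite_subset by blast
  have f: "int (f a) = w * int a mod int N" for a using N by (simp add: f_def)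
  have inj: "inj_on f A"
  proof (rule inj_onI)
    fix a b assume ab: "a \<in> A" "b \<in> A" "f a = f b"
    then have "[w * int a = w * int b] (mod int N)" using f by (metis cong_def)
    then have "[int a = int b] (mod int N)" using w by (simp add: cong_mult_lcancel)
    then have "[a = b] (mod N)" by (simp add: cong_int_iff)
    moreover have "a < N" "b < N" using A ab by auto
    ultimately show "a = b" by (simp add: cong_def)
  qed
  have copf: "coprime (int (f a)) (int N)" if "a \<in> A" for a
    using cop[OF that] w N by (simp add: f)
  have "\<not> coprime (int p) (int N)" using p by (simp add: coprime_iff_gcd_eq_1 gcd_nat.absorb1)
  then have "p \<notin> A" "p \<notin> f ` A" using cop copf by auto
  moreover have "f ` A \<subseteq> {1..<N}"
  proof
    fix y assume "y \<in> f ` A"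
    then obtain a where a: "a \<in> A" "y = f a" by auto
    have "y \<noteq> 0" using copf[OF a(1)] a(2) p by (auto intro: ccontr)
    moreover have "int y < int N" using a(2) f[of a] N by simp
    ultimately show "y \<in> {1..<N}" by auto
  qed
  ultimately have "A \<union> f ` A \<subseteq> {1..<N} - {p}" using A by auto
  then have "card (A \<union> f ` A) \<le> card ({1..<N} - {p})" by (intro card_mono) auto
  also have "\<dots> = N - 2" using p by simp
  also have "card (A \<union> f ` A) = card A + card (f ` A)"
    using notin fin by (intro card_Un_disjoint) (auto simp: f_def)
  also have "card (f ` A) = card A" using inj by (rule card_image)
  finally show ?thesis by simp
qed

text \<open>Only two terms of the binomial expansion survive, since \<open>M\<^sup>2\<close>
  vanishes modulo \<open>m\<close>.\<close>

lemma power_one_plus_cong: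
  fixes M :: int
  assumes "m dvd M\<^sup>2"
  shows "[(1 + M) ^ i = 1 + int i * M] (mod m)"
proof (induction i)
  case (Suc i)
  have "[(1 + M) * (1 + M) ^ i = (1 + M) * (1 + int i * M)] (mod m)"
    using Suc by (rule cong_scalar_left)
  also have "(1 + M) * (1 + int i * M) = 1 + int (Suc i) * M + int i * M\<^sup>2"
    by (simp add: algebra_simps power2_eq_square)
  also have "[\<dots> = 1 + int (Suc i) * M + 0] (mod m)"
    using assms by (intro cong_add cong_refl) (auto simp: cong_0_iff)
  finally show ?case by simp
qed simp

text \<open>The witness is \<open>1 + N div p\<close>. Its \<open>N\<close>-th power is 1, so if its
  power \<open>N - 1\<close> were 1 too, it would itself be 1 modulo \<open>N\<close>.\<close>

lemma fermat_witness_square: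
  fixes N p :: nat
  assumes "p\<^sup>2 dvd N" "1 < p" "0 < N"
  shows "\<exists>w. coprime w (int N) \<and> \<not> [w ^ (N - 1) = 1] (mod int N)"
proof -
  obtain t where t: "N = p * p * t" using assms by (auto simp: power2_eq_square)
  define M where "M = int (p * t)"
  define w where "w = 1 + M"
  have t0: "0 < t" using t assms by (intro gr0I) auto
  have "int N dvd M\<^sup>2" by (auto simp: M_def t power2_eq_square)
  from power_one_plus_cong[OF this] have "[w ^ N = 1 + int N * M] (mod int N)" by (simp add: w_def)
  also have "[1 + int N * M = 1 + 0] (mod int N)" by (intro cong_add) (auto simp: cong_0_iff)
  finally have wN: "[w ^ N = 1] (mod int N)" by simp
  have "\<not> [w ^ (N - 1) = 1] (mod int N)"
  proof
    assume "[w ^ (N - 1) = 1] (mod int N)"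
    then have "[w * w ^ (N - 1) = w * 1] (mod int N)" by (rule cong_scalar_left)
    then have "[w ^ N = w] (mod int N)" using assms by (simp flip: power_Suc)
    with wN have "[w = 1] (mod int N)" by (metis cong_sym cong_trans)
    then have "int N dvd int (p * t)" by (simp add: cong_iff_dvd_diff w_def M_def)
    then have "N dvd p * t" by (subst (asm) of_nat_dvd_iff)
    then have "p * p * t \<le> p * t" using t0 assms t by (intro dvd_imp_le) auto
    then show False using t0 assms by simp
  qed
  then show ?thesis using coprime_of_power_cong_unit[OF wN] assms by blast
qed

lemma fermat_witness_even:
  fixes N :: nat
  assumes "even N" "2 < N"
  shows "\<exists>w. coprime w (int N) \<and> \<not> [w ^ (N - 1) = 1] (mod int N)"
proof (intro exI conjI)
  have "odd (N - 1)" using assms by auto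
  then have "(- 1 :: int) ^ (N - 1) = - 1" by simp
  moreover have "\<not> int N dvd 2" using assms zdvd_imp_le by fastforce
  ultimately show "\<not> [(- 1) ^ (N - 1) = 1] (mod int N)" by (simp add: cong_iff_dvd_diff)
qed simp

text \<open>Starting from \<open>a ^ (N - 1) = 1\<close>, take square roots: as long as the value is
  1, the next root is 1 or \<open>- 1\<close>, and the descent ends at the odd part or at the first
  \<open>- 1\<close>. This recovers the classical strong probable prime condition.\<close>

lemma mr_pass_cases:
  assumes pass: "mr_pass N a" and N: "N - 1 = 2 ^ s * q"
  shows "[int a ^ q = 1] (mod int N) \<or> (\<exists>i<s. [int a ^ (2 ^ i * q) = - 1] (mod int N))"
proof -
  have "i \<le> s \<Longrightarrow> [int a ^ (2 ^ i * q) = 1] (mod int N) \<Longrightarrow>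
    [int a ^ q = 1] (mod int N) \<or> (\<exists>i<s. [int a ^ (2 ^ i * q) = - 1] (mod int N))" for i
  proof (induction i)
    case (Suc i)
    define j where "j = s - Suc i"
    have s: "s = Suc j + i" using Suc.prems by (simp add: j_def)
    have "(N - 1) div 2 ^ Suc j = 2 ^ i * q"
      unfolding N s power_add by (simp add: mult.assoc)
    moreover have "[(int a ^ (2 ^ i * q))\<^sup>2 = 1] (mod int N)"
      using Suc.prems(2) by (simp add: power_mult[symmetric] algebra_simps)
    ultimately have "[int a ^ (2 ^ i * q) = 1] (mod int N) \<or> [int a ^ (2 ^ i * q) = - 1] (mod int N)"
      using pass unfolding mr_pass_def by metis
    then show ?case using Suc by auto
  qed simp
  from this[of s] show ?thesis using pass N by (simp add: mr_pass_def)
qed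

text \<open>
  The bases that pass lie in a proper subgroup of the units. If \<open>N\<close> is even or not squarefree,
  this is the group of Fermat liars. Otherwise \<open>N = p * v\<close> with coprime odd factors; taking \<open>j\<close>
  maximal such that some \<open>b\<close> has \<open>b ^ (2 ^ j * q) = - 1\<close>, the group consists of all \<open>a\<close> with
  \<open>a ^ (2 ^ j * q) = 1\<close> or \<open>- 1\<close>, and it misses the unit that is \<open>b\<close> modulo \<open>p\<close> and 1 modulo \<open>v\<close>.
\<close>

theorem mr_pass_card:
  fixes N :: nat
  assumes "\<not> prime N" "4 \<le> N"
  shows "2 * card {a \<in> {1..<N}. mr_pass N a} \<le> N - 2"
proof -
  let ?A = "{a \<in> {1..<N}. mr_pass N a}"
  have cop: "coprime (int a) (int N)" if "a \<in> ?A" for a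
    using that assms by (intro coprime_of_power_cong_unit[of _ "N - 1"]) (auto simp: mr_pass_def)
  obtain p where p: "prime p" "p dvd N" using assms prime_factor_nat[of N] by auto
  have p1: "1 < p" using p prime_gt_1_nat by blast
  have pN: "p < N" using p assms by (metis dvd_imp_le le_neq_implies_less less_le_trans zero_less_numeral)
  have main: ?thesis if w: "coprime w (int N)"
    and H: "\<And>a. a \<in> ?A \<Longrightarrow> \<not> mr_pass N (nat (w * int a mod int N))" for w
    using H p p1 pN cop by (intro mult_notin_imp_card_le[of _ _ w p] w) auto
  have fermat: ?thesis if w: "coprime w (int N)" "\<not> [w ^ (N - 1) = 1] (mod int N)" for w
  proof (rule main[OF w(1)], rule notI)
    fix a assume a: "a \<in> ?A" and "mr_pass N (nat (w * int a mod int N))"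
    then have "[(w * int a mod int N) ^ (N - 1) = 1] (mod int N)"
      using assms by (simp add: mr_pass_def)
    then have "[(w * int a) ^ (N - 1) = 1] (mod int N)" by (simp add: cong_def power_mod)
    moreover have "[w ^ (N - 1) * int a ^ (N - 1) = w ^ (N - 1) * 1] (mod int N)"
      using a by (intro cong_scalar_left) (auto simp: mr_pass_def)
    ultimately have "[w ^ (N - 1) = 1] (mod int N)"
      by (metis cong_sym cong_trans mult.right_neutral power_mult_distrib)
    then show False using w by blast
  qed
  consider "even N" | "p\<^sup>2 dvd N" | "odd N" "\<not> p\<^sup>2 dvd N" by blast
  then show ?thesis
  proof cases
    case 1
    then show ?thesis using fermat fermat_witness_even[of N] assms by auto
  next
    case 2
    then show ?thesis using fermat fermat_witness_square[of p N] p1 assms by auto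
  next
    case 3
    obtain v where v: "N = p * v" using p by auto
    have "\<not> p dvd v" using 3 v by (auto simp: power2_eq_square)
    then have cpv: "coprime p v" using p by (simp add: prime_imp_coprime)
    have odd: "odd p" "odd v" using 3 v by auto
    have "v \<noteq> 1" using v assms p by auto
    then have v3: "2 < v" using odd(2) by (cases v; cases "v = 2") auto
    have p3: "2 < p" using odd(1) p1 by (cases "p = 2") auto
    obtain s q where sq: "N - 1 = 2 ^ s * q" "odd q"
    proof -
      have "N - 1 \<noteq> 0" "\<not> is_unit (2 :: nat)" using assms by auto
      from multiplicity_decompose'[OF this] show ?thesis using that by metis
    qed
    have s0: "0 < s" using sq 3 by (intro gr0I) auto
    define J where "J = {i. i < s \<and> (\<exists>b::nat. [int b ^ (2 ^ i * q) = - 1] (mod int N))}"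
    \<comment> \<open>The base \<open>N - 1\<close> stands for \<open>- 1\<close>, and
      \<open>q\<close> is odd, so level 0 belongs to \<open>J\<close> and a maximum exists.\<close>
    have "[int (N - 1) ^ q = (- 1) ^ q] (mod int N)"
      using assms by (intro cong_pow) (simp add: cong_iff_dvd_diff of_nat_diff)
    then have "0 \<in> J" unfolding J_def using s0 sq(2) by (auto intro!: exI[of _ "N - 1"])
    moreover have finJ: "finite J" by (simp add: J_def)
    ultimately have "Max J \<in> J" by (intro Max_in) auto
    define j where "j = Max J"
    obtain b :: nat where b: "[int b ^ (2 ^ j * q) = - 1] (mod int N)" and js: "j < s"
      using \<open>Max J \<in> J\<close> by (auto simp: J_def j_def)
    define e where "e = 2 ^ j * q"
    \<comment> \<open>A value 1 stays 1 under squaring. A value \<open>- 1\<close> at level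
      \<open>i\<close> has \<open>i \<le> j\<close> by maximality, so it either sits at level
      \<open>j\<close> or has been squared to 1 by then.\<close>
    have passH: "[int a ^ e = 1] (mod int N) \<or> [int a ^ e = - 1] (mod int N)" if "mr_pass N a" for a
      using mr_pass_cases[OF that sq(1)]
    proof
      assume "[int a ^ q = 1] (mod int N)"
      then have "[(int a ^ q) ^ 2 ^ j = 1 ^ 2 ^ j] (mod int N)" by (rule cong_pow)
      then show ?thesis by (simp add: e_def power_mult[symmetric] mult.commute)
    next
      assume "\<exists>i<s. [int a ^ (2 ^ i * q) = - 1] (mod int N)"
      then obtain i where i: "i < s" "[int a ^ (2 ^ i * q) = - 1] (mod int N)" by blast
      then have "i \<in> J" by (auto simp: J_def)
      then have "i \<le> j" using finJ by (simp add: j_def)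
      show ?thesis
      proof (cases "i = j")
        case False
        then obtain d where d: "j = i + Suc d" using \<open>i \<le> j\<close> by (metis less_iff_Suc_add nat_less_le add_Suc_right)
        have "[(int a ^ (2 ^ i * q)) ^ 2 ^ Suc d = (- 1) ^ 2 ^ Suc d] (mod int N)"
          using i(2) by (rule cong_pow)
        moreover have "(int a ^ (2 ^ i * q)) ^ 2 ^ Suc d = int a ^ e"
          by (simp add: e_def d power_add power_mult[symmetric] mult_ac)
        ultimately show ?thesis by simp
      qed (use i in \<open>simp add: e_def\<close>)
    qed
    obtain w :: nat where w: "[w = b] (mod p)" "[w = 1] (mod v)"
      using binary_chinese_remainder_nat[OF cpv] by blast
    have Nint: "int N = int p * int v" using v by simp
    have wp: "[int w ^ e = - 1] (mod int p)"
    proof -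
      have "[int w ^ e = int b ^ e] (mod int p)" using w(1) by (intro cong_pow) (simp add: cong_int_iff)
      moreover have "[int b ^ e = - 1] (mod int p)"
        using b unfolding e_def Nint by (rule cong_modulus_mult)
      ultimately show ?thesis by (rule cong_trans)
    qed
    have wv: "[int w ^ e = 1] (mod int v)"
      using cong_pow[of "int w" 1 "int v" e] w(2) cong_int_iff[of w 1 v] by simp
    have e0: "0 < e" using sq by (auto simp: e_def intro: gr0I)
    have notH: "\<not> ([int w ^ e = 1] (mod int N) \<or> [int w ^ e = - 1] (mod int N))"
    proof (intro notI, elim disjE)
      assume "[int w ^ e = 1] (mod int N)"
      then have "[int w ^ e = 1] (mod int p)" unfolding Nint by (rule cong_modulus_mult)
      with wp have "[- 1 = 1] (mod int p)" by (metis cong_sym cong_trans)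
      then show False using p3 zdvd_imp_le[of "int p" 2] by (simp add: cong_iff_dvd_diff)
    next
      assume "[int w ^ e = - 1] (mod int N)"
      then have "[int w ^ e = - 1] (mod int v)" unfolding Nint mult.commute[of "int p"] by (rule cong_modulus_mult)
      with wv have "[1 = - 1] (mod int v)" by (metis cong_sym cong_trans)
      then show False using v3 zdvd_imp_le[of "int v" 2] by (simp add: cong_iff_dvd_diff)
    qed
    have cw: "coprime (int w) (int N)"
    proof -
      have "[(int w ^ e)\<^sup>2 = (- 1)\<^sup>2] (mod int p)" using wp by (rule cong_pow)
      then have "[int w ^ (e * 2) = 1] (mod int p)" by (simp add: power_mult)
      then have "coprime (int w) (int p)" using e0 by (intro coprime_of_power_cong_unit[of _ "e * 2"]) auto
      moreover have "coprime (int w) (int v)" using wv e0 by (rule coprime_of_power_cong_unit)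
      ultimately show ?thesis by (simp add: Nint)
    qed
    show ?thesis
    proof (rule main[OF cw], rule notI)
      fix a assume a: "a \<in> ?A" and "mr_pass N (nat (int w * int a mod int N))"
      from passH[OF this(2)] have
        "[(int w * int a mod int N) ^ e = 1] (mod int N) \<or> [(int w * int a mod int N) ^ e = - 1] (mod int N)"
        using assms by simp
      then have wa: "[int w ^ e * int a ^ e = 1] (mod int N) \<or> [int w ^ e * int a ^ e = - 1] (mod int N)"
        by (simp add: cong_def power_mod power_mult_distrib)
      have "[int a ^ e = 1] (mod int N) \<or> [int a ^ e = - 1] (mod int N)" using a passH by simp
      then show False
      proof
        assume "[int a ^ e = 1] (mod int N)"
        then have "[int w ^ e * int a ^ e = int w ^ e * 1] (mod int N)" by (rule cong_scalar_left)
        with wa notH show False by (metis cong_sym cong_trans mult.right_neutral)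
      next
        assume "[int a ^ e = - 1] (mod int N)"
        then have "[int w ^ e * int a ^ e = int w ^ e * - 1] (mod int N)" by (rule cong_scalar_left)
        then have "[- (int w ^ e) = 1] (mod int N) \<or> [- (int w ^ e) = - 1] (mod int N)"
          using wa by (metis cong_sym cong_trans mult_minus1_right)
        then show False using notH cong_minus_minus_iff[of "int w ^ e" "- 1"] cong_minus_minus_iff[of "int w ^ e" 1]
          by auto
      qed
    qed
  qed
qed

section \<open>Reasoning about programs\<close>

definition skip :: prog where "skip = Instr (Copy 0 0)"

definition block :: "instr list \<Rightarrow> prog \<Rightarrow> prog" where
  "block is p = foldr (\<lambda>i. Seq (Instr i)) is p"

text \<open>A plain function on memories, so that the effect of a straight-line block is the term
  \<open>fold det_mem is M\<close>, which the simplifier evaluates.\<close>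

fun det_mem :: "instr \<Rightarrow> (nat \<Rightarrow> nat) \<Rightarrow> nat \<Rightarrow> nat" where
  "det_mem (Const r a) M = M(r := a)"
| "det_mem (Copy r s) M = M(r := M s)"
| "det_mem (Load r s) M = M(r := M (M s))"
| "det_mem (Store r s) M = M(M r := M s)"
| "det_mem (Add r s t) M = M(r := M s + M t)"
| "det_mem (Sub r s t) M = M(r := M s - M t)"
| "det_mem (Mul r s t) M = M(r := M s * M t)"
| "det_mem (Div r s t) M = M(r := M s div M t)"
| "det_mem (instr.Mod r s t) M = M(r := M s mod M t)"
| "det_mem (Coin r) M = M"
| "det_mem (Emit r) M = M"

fun is_det :: "instr \<Rightarrow> bool" where
  "is_det (Coin r) = False"
| "is_det (Emit r) = False"
| "is_det _ = True"

lemma instr_det: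
  "is_det i \<Longrightarrow> instr_mem i M = return_pmf (det_mem i M)"
  "is_det i \<Longrightarrow> instr_out i M = []"
  by (cases i; simp)+

text \<open>The abstract counterpart of a counted loop: \<open>D\<close> sees the number of
  iterations still to follow.\<close>

primrec iter_pmf :: "(nat \<Rightarrow> 'a \<Rightarrow> 'a pmf) \<Rightarrow> nat \<Rightarrow> 'a \<Rightarrow> 'a pmf" where
  "iter_pmf D 0 a = return_pmf a"
| "iter_pmf D (Suc j) a = bind_pmf (D j a) (iter_pmf D j)"

text \<open>The fixed point is unfolded only here. Loops are handled afterwards by induction on a
  counter, so termination comes out of the coupling with a proper distribution.\<close>

lemma exec_while:
  "exec (While_Nonzero r p) s =
     (if mem s r \<noteq> 0 then bind_spmf (exec p (charge_test r s)) (exec (While_Nonzero r p))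
      else return_spmf (charge_test r s))"
proof -
  have a: "exec (While_Nonzero r p) = (\<lambda>s. map_spmf (charge_test r) (while_spmf (\<lambda>s. mem s r \<noteq> 0) (\<lambda>s. exec p (charge_test r s)) s))"
   by (simp only: exec.simps)
  show ?thesis
  proof (cases "mem s r = 0")
    case True
    then show ?thesis unfolding a by (subst while_spmf.simps) simp
  next
    case False
    then have "exec (While_Nonzero r p) s = map_spmf (charge_test r) (bind_spmf (exec p (charge_test r s)) (while_spmf (\<lambda>s. mem s r \<noteq> 0) (\<lambda>s. exec p (charge_test r s))))"
      unfolding a by (subst while_spmf.simps) (simp only: not_False_eq_True if_True)
    then show ?thesis using False unfolding a by (simp only: map_spmf_bind_spmf o_def not_False_eq_True if_True)
  qed
qed

text \<open>
  Registers below 16 are working registers; the registers from 16 on hold the dictionary of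
  numbers that were output, each being its own address.
\<close>

locale ram_bounds =
  fixes B X K :: nat
  assumes B_pos: "0 < B"
begin

definition good :: "(nat \<Rightarrow> nat) \<Rightarrow> nat list \<Rightarrow> bool" where
  "good M xs \<longleftrightarrow> (\<forall>r<16. M r < 2 ^ B) \<and> (\<forall>r\<ge>16. M r \<noteq> 0 \<longrightarrow> r \<in> set xs \<and> M r = 1) \<and>
     length xs \<le> K \<and> (\<forall>x\<in>set xs. x \<le> X)"

text \<open>Addresses of working registers have at most 4 bits. Each number output is charged twice,
  as an output entry and as the address of a dictionary register whose content is one bit.\<close>

definition max_space :: nat where
  "max_space = 16 * (4 + B) + K * (2 * bits X + 2)"

definition unit_cost :: nat where
  "unit_cost = (1 + B) * (1 + B)"

lemma one_less_word: "Suc 0 < 2 ^ B"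
  using B_pos one_less_power[of "2 :: nat" B] by simp

lemma good_upd: "good M xs \<Longrightarrow> r < 16 \<Longrightarrow> v < 2 ^ B \<Longrightarrow> good (M(r := v)) xs"
  by (auto simp: good_def)

lemma good_space:
  assumes "good M xs"
  shows "space_in_use M xs \<le> max_space"
proof -
  have lenK: "length xs \<le> K" using assms by (simp add: good_def)
  have out: "1 + bits x \<le> bits X + 1" if "x \<in> set xs" for x
    using assms that by (auto simp: good_def intro: floorlog_mono)
  have "(\<Sum>x\<leftarrow>xs. 1 + bits x) \<le> (\<Sum>x\<leftarrow>xs. bits X + 1)"
    using out by (intro sum_list_mono) auto
  also have "\<dots> = length xs * (bits X + 1)" by (simp add: sum_list_triv)
  also have "\<dots> \<le> K * (bits X + 1)" using lenK by (rule mult_le_mono1)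
  finally have 1: "(\<Sum>x\<leftarrow>xs. 1 + bits x) \<le> K * (bits X + 1)" .
  let ?f = "\<lambda>r. bits r + bits (M r)"
  have "(\<Sum>r | M r \<noteq> 0. ?f r) \<le> sum ?f ({..<16} \<union> (set xs \<inter> {r. 16 \<le> r \<and> M r = 1}))"
    using assms by (intro sum_mono2) (auto simp: good_def not_less)
  also have "\<dots> \<le> sum ?f {..<16} + sum ?f (set xs \<inter> {r. 16 \<le> r \<and> M r = 1})"
    by (subst sum.union_disjoint) auto
  also have "sum ?f {..<16} \<le> (\<Sum>r<16::nat. 4 + B)"
    using assms by (intro sum_mono add_mono floorlog_leI) (auto simp: good_def)
  also have "\<dots> = 16 * (4 + B)" by simp
  also have "sum ?f (set xs \<inter> {r. 16 \<le> r \<and> M r = 1}) \<le> of_nat (card (set xs \<inter> {r. 16 \<le> r \<and> M r = 1})) * (bits X + 1)"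
  proof (rule sum_bounded_above)
    fix r assume r: "r \<in> set xs \<inter> {r. 16 \<le> r \<and> M r = 1}"
    then have "bits r \<le> bits X" using assms by (auto simp: good_def intro: floorlog_mono)
    moreover have "bits (M r) \<le> 1" using r by (intro floorlog_leI) auto
    ultimately show "?f r \<le> bits X + 1" by linarith
  qed
  also have "of_nat (card (set xs \<inter> {r. 16 \<le> r \<and> M r = 1})) * (bits X + 1) \<le> K * (bits X + 1)"
  proof -
    have "card (set xs \<inter> {r. 16 \<le> r \<and> M r = 1}) \<le> card (set xs)" by (intro card_mono) auto
    also have "\<dots> \<le> K" using card_length lenK le_trans by blast
    finally show ?thesis by (intro mult_le_mono1) simp
  qed
  finally have 2: "(\<Sum>r | M r \<noteq> 0. ?f r) \<le> 16 * (4 + B) + K * (bits X + 1)" by simp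
  show ?thesis using 1 2 by (simp add: space_in_use_def max_space_def algebra_simps)
qed

lemma good_bits: "good M xs \<Longrightarrow> bits (M r) \<le> B"
proof (cases "r < 16")
  case False
  moreover assume "good M xs"
  ultimately have "M r \<le> 1" unfolding good_def by (metis le_refl not_less zero_le)
  also have "1 < (2::nat) ^ B" using one_less_word by simp
  finally show ?thesis by (intro floorlog_leI) auto
qed (auto simp: good_def intro: floorlog_leI)

lemma instr_cost_le:
  assumes "good M xs" and "is_det i \<Longrightarrow> good (det_mem i M) xs"
  shows "instr_cost M i \<le> unit_cost"
proof -
  have b: "bits (M r) \<le> B" for r using assms(1) by (rule good_bits)
  have lin: "1 + u + v \<le> unit_cost" if "u \<le> B" "v \<le> B" for u v
    using that by (simp add: unit_cost_def)
  have quad: "(1 + u) * (1 + v) \<le> unit_cost" if "u \<le> B" "v \<le> B" for u v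
    unfolding unit_cost_def using that by (intro mult_le_mono) auto
  show ?thesis
  proof (cases i)
    case (Const r a)
    \<comment> \<open>The length of the literal is controlled through the register that receives
      it.\<close>
    then have "bits a \<le> B" using good_bits[OF assms(2), of r] by simp
    then show ?thesis using lin[of "bits a" 0] Const by simp
  qed (use lin[OF b b] quad[OF b b] lin[OF b, of 0] lin[of 0 0] in auto)
qed

text \<open>
  A coupling of a run with an abstract distribution \<open>D\<close>: it transports the distribution of the
  results, termination, and the worst-case bounds on time and space at once. Time is counted in
  instructions, each of which costs at most \<open>unit_cost\<close> bit operations.
\<close>

definition exec_rel ::
  "prog \<Rightarrow> nat \<Rightarrow> (nat \<Rightarrow> nat) \<Rightarrow> nat list \<Rightarrow> 'a pmf \<Rightarrow> ('a \<Rightarrow> (nat \<Rightarrow> nat) \<Rightarrow> nat list \<Rightarrow> bool) \<Rightarrow> bool" where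
  "exec_rel p t M xs D Q \<longleftrightarrow> (\<forall>s. mem s = M \<and> outp s = xs \<and> peak_space s \<le> max_space \<and> good M xs \<longrightarrow>
     rel_spmf (\<lambda>s' a. Q a (mem s') (outp s') \<and> good (mem s') (outp s') \<and> peak_space s' \<le> max_space \<and>
        bit_ops s' \<le> bit_ops s + t * unit_cost) (exec p s) (spmf_of_pmf D))"

lemma exec_rel_good: "(good M xs \<Longrightarrow> exec_rel p t M xs D Q) \<Longrightarrow> exec_rel p t M xs D Q"
  by (auto simp: exec_rel_def)

lemma exec_rel_conseq:
  assumes "exec_rel p t M xs D Q" "t \<le> t'"
    and "\<And>a M' xs'. Q a M' xs' \<Longrightarrow> good M' xs' \<Longrightarrow> Q' a M' xs'"
  shows "exec_rel p t' M xs D Q'"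
  unfolding exec_rel_def
proof (intro allI impI)
  fix s :: ram_state assume s: "mem s = M \<and> outp s = xs \<and> peak_space s \<le> max_space \<and> good M xs"
  have "t * unit_cost \<le> t' * unit_cost" using assms(2) by simp
  then show "rel_spmf (\<lambda>s' a. Q' a (mem s') (outp s') \<and> good (mem s') (outp s') \<and> peak_space s' \<le> max_space \<and>
        bit_ops s' \<le> bit_ops s + t' * unit_cost) (exec p s) (spmf_of_pmf D)"
    using assms(1,3) s unfolding exec_rel_def
    by (elim allE[of _ s] impE) (simp, erule rel_spmf_mono, use order_trans in fastforce)
qed

lemma exec_rel_time: "exec_rel p t M xs D Q \<Longrightarrow> t \<le> t' \<Longrightarrow> exec_rel p t' M xs D Q"
  by (rule exec_rel_conseq)

lemma exec_rel_map:
  "exec_rel p t M xs D (\<lambda>a. Q (f a)) \<Longrightarrow> exec_rel p t M xs (map_pmf f D) Q"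
  unfolding exec_rel_def map_spmf_of_pmf[symmetric] spmf_rel_map2 .

lemma exec_rel_Seq:
  assumes 1: "exec_rel p t M xs D R"
    and 2: "\<And>a M' xs'. R a M' xs' \<Longrightarrow> good M' xs' \<Longrightarrow> exec_rel q t' M' xs' (E a) Q"
  shows "exec_rel (Seq p q) (t + t') M xs (bind_pmf D E) Q"
  unfolding exec_rel_def
proof (intro allI impI)
  fix s :: ram_state assume s: "mem s = M \<and> outp s = xs \<and> peak_space s \<le> max_space \<and> good M xs"
  show "rel_spmf (\<lambda>s' a. Q a (mem s') (outp s') \<and> good (mem s') (outp s') \<and> peak_space s' \<le> max_space \<and>
      bit_ops s' \<le> bit_ops s + (t + t') * unit_cost) (exec (Seq p q) s) (spmf_of_pmf (bind_pmf D E))"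
    unfolding exec.simps spmf_of_pmf_bind bind_spmf_of_pmf[symmetric]
  proof (rule rel_spmf_bindI)
    show "rel_spmf (\<lambda>s' a. R a (mem s') (outp s') \<and> good (mem s') (outp s') \<and> peak_space s' \<le> max_space \<and>
        bit_ops s' \<le> bit_ops s + t * unit_cost) (exec p s) (spmf_of_pmf D)"
      using 1 s by (simp add: exec_rel_def)
  next
    fix s' :: ram_state and a
    assume s': "R a (mem s') (outp s') \<and> good (mem s') (outp s') \<and> peak_space s' \<le> max_space \<and>
        bit_ops s' \<le> bit_ops s + t * unit_cost"
    then have "exec_rel q t' (mem s') (outp s') (E a) Q" using 2 by blast
    then show "rel_spmf (\<lambda>s' a. Q a (mem s') (outp s') \<and> good (mem s') (outp s') \<and> peak_space s' \<le> max_space \<and>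
      bit_ops s' \<le> bit_ops s + (t + t') * unit_cost) (exec q s') (spmf_of_pmf (E a))"
      using s' unfolding exec_rel_def
      by (elim allE[of _ s'] impE) (simp, erule rel_spmf_mono, auto simp: algebra_simps)
  qed
qed

lemma exec_rel_Seq_unit:
  assumes "exec_rel p t M xs (return_pmf ()) R"
    and "\<And>M' xs'. R () M' xs' \<Longrightarrow> good M' xs' \<Longrightarrow> exec_rel q t' M' xs' E Q"
  shows "exec_rel (Seq p q) (t + t') M xs E Q"
  using exec_rel_Seq[OF assms(1), of q t' "\<lambda>_. E" Q] assms(2) by (simp add: bind_return_pmf)

lemma exec_rel_det:
  assumes "is_det i" "good M xs \<Longrightarrow> good (det_mem i M) xs" "Q a (det_mem i M) xs"
  shows "exec_rel (Instr i) 1 M xs (return_pmf a) Q"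
proof -
  have "space_in_use (det_mem i M) xs \<le> max_space" "instr_cost M i \<le> unit_cost" if "good M xs"
    using that assms good_space instr_cost_le by blast+
  then show ?thesis using assms
    by (auto simp: exec_rel_def exec_instr_def instr_det Let_def)
qed

lemma exec_rel_coin:
  assumes "r < 16"
  shows "exec_rel (Instr (Coin r)) 1 M xs (bernoulli_pmf (1/2)) (\<lambda>b M' xs'. xs' = xs \<and> M' = M(r := of_bool b))"
proof -
  have g: "good (M(r := of_bool b)) xs" if "good M xs" for b
    using that assms one_less_word by (intro good_upd) auto
  then have "space_in_use (M(r := of_bool b)) xs \<le> max_space" if "good M xs" for b
    using good_space that by blast
  moreover have "1 \<le> unit_cost" by (simp add: unit_cost_def)
  ultimately show ?thesis using g
    by (auto simp: exec_rel_def exec_instr_def Let_def spmf_rel_map1 pmf.rel_map simp flip: map_spmf_of_pmf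
        intro!: rel_pmf_reflI)
qed

lemma exec_rel_emit:
  assumes "r < 16" "M r \<le> X" "length xs < K" "Q a M (xs @ [M r])"
  shows "exec_rel (Instr (Emit r)) 1 M xs (return_pmf a) Q"
proof -
  have g: "good M (xs @ [M r])" if "good M xs" using that assms by (auto simp: good_def)
  then have "space_in_use M (xs @ [M r]) \<le> max_space" if "good M xs" using good_space that by blast
  moreover have "instr_cost M (Emit r) \<le> unit_cost" if "good M xs" using that by (intro instr_cost_le) auto
  ultimately show ?thesis using g assms
    by (auto simp: exec_rel_def exec_instr_def Let_def)
qed

lemma charge_test_le:
  assumes "good (mem s) xs"
  shows "bit_ops (charge_test r s) \<le> bit_ops s + unit_cost"
proof -
  have "bits (mem s r) \<le> B" using assms by (rule good_bits)
  then show ?thesis by (simp add: charge_test_def unit_cost_def)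
qed

lemma charge_test_simps [simp]:
  "mem (charge_test r s) = mem s" "outp (charge_test r s) = outp s"
  "peak_space (charge_test r s) = peak_space s"
  by (simp_all add: charge_test_def)

lemma exec_rel_If:
  assumes "M r \<noteq> 0 \<Longrightarrow> exec_rel p t M xs D Q" "M r = 0 \<Longrightarrow> exec_rel q t M xs D Q"
  shows "exec_rel (If_Nonzero r p q) (1 + t) M xs D Q"
  unfolding exec_rel_def
proof (intro allI impI)
  fix s :: ram_state assume s: "mem s = M \<and> outp s = xs \<and> peak_space s \<le> max_space \<and> good M xs"
  have c: "bit_ops (charge_test r s) \<le> bit_ops s + unit_cost" using s charge_test_le by blast
  have "exec_rel (if M r \<noteq> 0 then p else q) t M xs D Q" using assms by simp
  then have "rel_spmf (\<lambda>s' a. Q a (mem s') (outp s') \<and> good (mem s') (outp s') \<and> peak_space s' \<le> max_space \<and>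
      bit_ops s' \<le> bit_ops (charge_test r s) + t * unit_cost)
      (exec (if M r \<noteq> 0 then p else q) (charge_test r s)) (spmf_of_pmf D)"
    using s unfolding exec_rel_def by simp
  moreover have "exec (If_Nonzero r p q) s = exec (if M r \<noteq> 0 then p else q) (charge_test r s)"
    using s by simp
  ultimately show "rel_spmf (\<lambda>s' a. Q a (mem s') (outp s') \<and> good (mem s') (outp s') \<and> peak_space s' \<le> max_space \<and>
      bit_ops s' \<le> bit_ops s + (1 + t) * unit_cost) (exec (If_Nonzero r p q) s) (spmf_of_pmf D)"
    using c by (simp only:) (erule rel_spmf_mono, auto simp: algebra_simps)
qed

lemma exec_rel_while_0:
  assumes "M r = 0" "Q a M xs"
  shows "exec_rel (While_Nonzero r p) 1 M xs (return_pmf a) Q"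
  unfolding exec_rel_def
proof (intro allI impI)
  fix s :: ram_state assume s: "mem s = M \<and> outp s = xs \<and> peak_space s \<le> max_space \<and> good M xs"
  then have "exec (While_Nonzero r p) s = return_spmf (charge_test r s)"
    using assms by (subst exec_while) simp
  then show "rel_spmf (\<lambda>s' a. Q a (mem s') (outp s') \<and> good (mem s') (outp s') \<and> peak_space s' \<le> max_space \<and>
      bit_ops s' \<le> bit_ops s + 1 * unit_cost) (exec (While_Nonzero r p) s) (spmf_of_pmf (return_pmf a))"
    using s assms charge_test_le[of s xs r] by (simp del: exec.simps)
qed

text \<open>A loop whose guard holds behaves like a branch into body and loop, so the rules for
  \<open>If_Nonzero\<close> and \<open>Seq\<close> do the accounting.\<close>

lemma exec_rel_while_step:
  assumes "M r \<noteq> 0" "exec_rel p t M xs D R"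
    and "\<And>a M' xs'. R a M' xs' \<Longrightarrow> good M' xs' \<Longrightarrow> exec_rel (While_Nonzero r p) t' M' xs' (E a) Q"
  shows "exec_rel (While_Nonzero r p) (1 + t + t') M xs (bind_pmf D E) Q"
proof -
  have "exec_rel (Seq p (While_Nonzero r p)) (t + t') M xs (bind_pmf D E) Q"
    using assms(2,3) by (rule exec_rel_Seq)
  then have "exec_rel (If_Nonzero r (Seq p (While_Nonzero r p)) skip) (1 + (t + t')) M xs (bind_pmf D E) Q"
    using assms(1) by (intro exec_rel_If) auto
  moreover have "exec (While_Nonzero r p) s = exec (If_Nonzero r (Seq p (While_Nonzero r p)) skip) s"
    if "mem s = M" for s
    using that assms(1) by (subst exec_while) (simp del: exec.simps(4))
  then have "exec_rel (If_Nonzero r (Seq p (While_Nonzero r p)) skip) u M xs D' Q \<Longrightarrow>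
      exec_rel (While_Nonzero r p) u M xs D' Q" for u D'
    unfolding exec_rel_def by (simp del: exec.simps)
  ultimately show ?thesis by (simp add: add.assoc)
qed

text \<open>The invariant ties the counter \<open>j\<close> to the state; the guard register need
  not contain \<open>j\<close>, it only has to be nonzero until \<open>j\<close> reaches 0. The
  extra unit of time is the last, failing test.\<close>

lemma exec_rel_for:
  assumes "Inv j a M xs"
    and zero: "\<And>a M xs. Inv 0 a M xs \<Longrightarrow> M r = 0"
    and step: "\<And>j a M xs. Inv (Suc j) a M xs \<Longrightarrow> good M xs \<Longrightarrow>
      M r \<noteq> 0 \<and> exec_rel p t M xs (D j a) (\<lambda>a'. Inv j a')"
  shows "exec_rel (While_Nonzero r p) (j * (1 + t) + 1) M xs (iter_pmf D j a) (\<lambda>a'. Inv 0 a')"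
  using assms(1)
proof (induction j arbitrary: a M xs)
  case 0
  then show ?case unfolding iter_pmf.simps mult_0 add_0 using zero by (intro exec_rel_while_0) blast+
next
  case (Suc j)
  have "exec_rel (While_Nonzero r p) (1 + t + (j * (1 + t) + 1)) M xs (iter_pmf D (Suc j) a) (\<lambda>a'. Inv 0 a')"
    if "good M xs"
    unfolding iter_pmf.simps
    using step[OF Suc.prems that] Suc.IH by (intro exec_rel_while_step[where R = "\<lambda>a'. Inv j a'"]) auto
  then have "good M xs \<Longrightarrow> exec_rel (While_Nonzero r p) (Suc j * (1 + t) + 1) M xs (iter_pmf D (Suc j) a) (\<lambda>a'. Inv 0 a')"
    by (simp add: algebra_simps)
  then show ?case by (rule exec_rel_good)
qed

lemma exec_rel_skip:
  "Q a M xs \<Longrightarrow> exec_rel skip 1 M xs (return_pmf a) Q"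
  unfolding skip_def by (rule exec_rel_det) auto

text \<open>Peak space is measured after every instruction, so intermediate memories must be good as
  well, not just the final one.\<close>

primrec safe :: "instr list \<Rightarrow> (nat \<Rightarrow> nat) \<Rightarrow> nat list \<Rightarrow> bool" where
  "safe [] M xs = True"
| "safe (i # is) M xs \<longleftrightarrow> is_det i \<and> good (det_mem i M) xs \<and> safe is (det_mem i M) xs"

lemma exec_rel_block:
  assumes "good M xs \<Longrightarrow> safe is M xs" "exec_rel p t (fold det_mem is M) xs D Q"
  shows "exec_rel (block is p) (length is + t) M xs D Q"
  using assms
proof (induction "is" arbitrary: M)
  case Nil
  then show ?case by (simp add: block_def)
next
  case (Cons i "is")
  have "exec_rel (block (i # is) p) (1 + (length is + t)) M xs (bind_pmf (return_pmf ()) (\<lambda>_. D)) Q"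
    if g: "good M xs"
  proof -
    have i: "is_det i" "good (det_mem i M) xs" "safe is (det_mem i M) xs" using Cons.prems(1) g by auto
    have "exec_rel (Instr i) 1 M xs (return_pmf ()) (\<lambda>_ M' xs'. M' = det_mem i M \<and> xs' = xs)"
      using i by (intro exec_rel_det) auto
    moreover have "exec_rel (block is p) (length is + t) (det_mem i M) xs D Q"
      using Cons i by auto
    ultimately have "exec_rel (Seq (Instr i) (block is p)) (1 + (length is + t)) M xs (bind_pmf (return_pmf ()) (\<lambda>_. D)) Q"
      by (intro exec_rel_Seq[where R = "\<lambda>_ M' xs'. M' = det_mem i M \<and> xs' = xs"]) auto
    then show ?thesis by (simp add: block_def)
  qed
  then have "good M xs \<Longrightarrow> exec_rel (block (i # is) p) (length (i # is) + t) M xs D Q"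
    by (simp add: bind_return_pmf)
  then show ?case by (rule exec_rel_good)
qed

end

section \<open>The program\<close>

text \<open>
  Register map: 0 holds \<open>n\<close>, 1 the number of primes still to be found, 2 the bit length \<open>L\<close> of
  \<open>n\<close>, 3 the remaining tries, 4 the candidate, 5 the remaining rounds, 6 the base, 7 the verdict
  of the test, 8 the power of two that drives the current loop, 10 the running power, 13 the
  constant 1, 14 the constant 2, 15 the number \<open>4 ^ L\<close>; 9, 11 and 12 are scratch.
\<close>

definition sample :: "nat \<Rightarrow> prog" where
  "sample r = block [Const r 0, Copy 8 15]
     (While_Nonzero 8 (Seq (Instr (Coin 9)) (block [Add r r r, Add r r 9, Div 8 8 14] skip)))"

text \<open>
  One step of left-to-right exponentiation without branching: by truncated subtraction,
  \<open>1 - (y - 1 + (1 - y))\<close> is 1 if \<open>y = 1\<close> and 0 otherwise, so register 7 is cleared exactly if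
  squaring the running power \<open>x\<close> yields 1 although \<open>x\<close> is neither 1 nor \<open>N - 1\<close>.
\<close>

definition mr_loop :: prog where
  "mr_loop = While_Nonzero 8 (block
     [Mul 9 10 10, instr.Mod 9 9 4,
      Sub 11 9 13, Sub 12 13 9, Add 11 11 12, Sub 11 13 11,
      Sub 12 10 13, Mul 11 11 12, Sub 12 4 13, Sub 12 12 10, Mul 11 11 12,
      Sub 11 13 11, Mul 7 7 11,
      Sub 12 4 13, Div 12 12 8, instr.Mod 12 12 14,
      Sub 11 6 13, Mul 11 11 12, Add 11 11 13,
      Mul 10 9 11, instr.Mod 10 10 4, Div 8 8 14] skip)"

text \<open>The first \<open>Sub\<close> and \<open>Add\<close> replace a base 0 by 1, which always
  passes; otherwise a prime could be rejected. The block after the loop checks by the same truncated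
  arithmetic that the final power is 1.\<close>

definition mr_round :: prog where
  "mr_round = Seq (sample 6) (block [instr.Mod 6 6 4, Sub 9 13 6, Add 6 6 9, Const 10 1, Copy 8 15]
     (Seq mr_loop (block [Sub 11 10 13, Sub 12 13 10, Add 11 11 12, Sub 11 13 11, Mul 7 7 11] skip)))"

definition mr_test :: "nat \<Rightarrow> prog" where
  "mr_test c1 = block [Const 7 1, Const 9 c1, Mul 5 9 2]
     (While_Nonzero 5 (block [Sub 5 5 13] mr_round))"

text \<open>Register 11 holds \<open>(x - n\<^sup>2) + (n - x)\<close> in truncated arithmetic,
  nonzero exactly outside the range. \<open>Emit\<close> comes before \<open>Store\<close>, so that
  no dictionary register is ever set for a number missing from the output, as \<open>good\<close>
  demands. Clearing register 3 ends the slot.\<close>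

definition try_prog :: "nat \<Rightarrow> prog" where
  "try_prog c1 = Seq (sample 4) (block [Mul 9 0 0, Sub 11 4 9, Sub 12 0 4, Add 11 11 12]
     (If_Nonzero 11 skip (block [Load 7 4] (If_Nonzero 7 skip
        (Seq (mr_test c1)
           (If_Nonzero 7 (Seq (Instr (Emit 4)) (block [Store 4 13, Const 3 0] skip)) skip))))))"

definition slot_prog :: "nat \<Rightarrow> nat \<Rightarrow> prog" where
  "slot_prog c1 c2 = block [Const 9 c2, Mul 3 9 2, Mul 3 3 2]
     (While_Nonzero 3 (block [Sub 3 3 13] (try_prog c1)))"

definition prime_prog :: "nat \<Rightarrow> nat \<Rightarrow> prog" where
  "prime_prog c1 c2 = block [Const 13 1, Const 14 2, Const 15 1, Copy 8 0]
     (Seq (While_Nonzero 8 (block [Div 8 8 14, Add 2 2 13, Add 15 15 15, Add 15 15 15] skip))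
        (While_Nonzero 1 (block [Sub 1 1 13] (slot_prog c1 c2))))"

section \<open>Distributions and arithmetic behind the loops\<close>

lemma iter_pmf_return: "iter_pmf (\<lambda>_ _. return_pmf a) j a = return_pmf a"
  by (induction j) (simp_all add: bind_return_pmf)

text \<open>Generalised to a prefix \<open>x\<close> already drawn: the interval of completions of
  \<open>x\<close> splits into those of \<open>2 * x\<close> and \<open>2 * x + 1\<close>, each
  taken with probability one half. The inequality of truth values in the proof expresses this
  disjoint union.\<close>

lemma iter_pmf_coin:
  "iter_pmf (\<lambda>_ x. map_pmf (\<lambda>b. 2 * x + of_bool b) (bernoulli_pmf (1/2))) j x =
     pmf_of_set {x * 2 ^ j..<Suc x * 2 ^ j}"
proof (induction j arbitrary: x)
  case 0
  then show ?case by (simp add: pmf_of_set_singleton)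
next
  case (Suc j)
  have ne: "{y * 2 ^ i..<y * 2 ^ i + 2 ^ i} \<noteq> {}" for y i :: nat by simp
  show ?case
  proof (rule pmf_eqI)
    fix v
    have "x * 2 ^ Suc j \<le> v \<and> v < Suc x * 2 ^ Suc j \<longleftrightarrow>
      ((2 * x) * 2 ^ j \<le> v \<and> v < Suc (2 * x) * 2 ^ j) \<noteq> (Suc (2 * x) * 2 ^ j \<le> v \<and> v < Suc (Suc (2 * x)) * 2 ^ j)"
      by (auto simp: algebra_simps)
    then show "pmf (iter_pmf (\<lambda>_ x. map_pmf (\<lambda>b. 2 * x + of_bool b) (bernoulli_pmf (1/2))) (Suc j) x) v =
      pmf (pmf_of_set {x * 2 ^ Suc j..<Suc x * 2 ^ Suc j}) v"
      using ne[of x "Suc j"] ne[of "2 * x" j] ne[of "Suc (2 * x)" j]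
      by (auto simp: bind_map_pmf Suc.IH pmf_bind indicator_def)
  qed
qed

definition no_root :: "nat \<Rightarrow> nat \<Rightarrow> nat \<Rightarrow> bool" where
  "no_root N a i \<longleftrightarrow> ([(int a ^ ((N - 1) div 2 ^ Suc i))\<^sup>2 = 1] (mod int N) \<longrightarrow>
        [int a ^ ((N - 1) div 2 ^ Suc i) = 1] (mod int N) \<or>
        [int a ^ ((N - 1) div 2 ^ Suc i) = - 1] (mod int N))"

lemma mr_pass_iff:
  assumes "2 \<le> N"
  shows "mr_pass N a \<longleftrightarrow> a ^ (N - 1) mod N = 1 \<and> (\<forall>i. no_root N a i)"
proof -
  have "[int a ^ (N - 1) = 1] (mod int N) \<longleftrightarrow> [a ^ (N - 1) = 1] (mod N)"
    using cong_int_iff[of "a ^ (N - 1)" 1 N] by simp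
  also have "\<dots> \<longleftrightarrow> a ^ (N - 1) mod N = 1" using assms by (simp add: cong_def)
  finally show ?thesis by (simp add: mr_pass_def no_root_def)
qed

lemma no_root_arith:
  fixes N x y e :: nat
  assumes N: "2 \<le> N" and x: "x = a ^ ((N - 1) div 2 ^ Suc i) mod N" and y: "y = x * x mod N"
  shows "1 - (1 - ((y - 1) + (1 - y))) * (x - 1) * (N - 1 - x) = of_bool (no_root N a i)"
proof -
  define z where "z = a ^ ((N - 1) div 2 ^ Suc i)"
  have xN: "x < N" using x N by simp
  have zi: "int a ^ ((N - 1) div 2 ^ Suc i) = int z" by (simp add: z_def)
  have 1: "[(int z)\<^sup>2 = 1] (mod int N) \<longleftrightarrow> y = 1"
  proof -
    have "[(int z)\<^sup>2 = 1] (mod int N) \<longleftrightarrow> [z * z = 1] (mod N)"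
      using cong_int_iff[of "z * z" 1 N] by (simp add: power2_eq_square)
    also have "\<dots> \<longleftrightarrow> y = 1" using N by (simp add: cong_def y x z_def mod_mult_eq)
    finally show ?thesis .
  qed
  have 2: "[int z = 1] (mod int N) \<longleftrightarrow> x = 1"
    using cong_int_iff[of z 1 N] N by (simp add: cong_def x z_def)
  have 3: "[int z = - 1] (mod int N) \<longleftrightarrow> x = N - 1"
  proof -
    have "[int z = - 1] (mod int N) \<longleftrightarrow> [int z = int (N - 1)] (mod int N)"
    proof -
      have "[int (N - 1) = - 1] (mod int N)" using N by (simp add: cong_iff_dvd_diff of_nat_diff)
      then show ?thesis by (metis cong_sym cong_trans)
    qed
    also have "\<dots> \<longleftrightarrow> x = N - 1" using N by (simp only: cong_int_iff) (simp add: cong_def x z_def)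
    finally show ?thesis .
  qed
  \<comment> \<open>The truncated \<open>x - 1\<close> vanishes for \<open>x = 0\<close> as well as
    for \<open>x = 1\<close>; the former is excluded when the square is 1.\<close>
  have "x \<noteq> 0" if "y = 1" using that y by (auto intro: ccontr)
  then show ?thesis unfolding no_root_def zi 1 2 3 using xN by auto
qed

text \<open>The exponent grows by one binary digit: square, then multiply by \<open>a ^ bit\<close>,
  which is written \<open>(a - 1) * bit + 1\<close> to avoid a branch.\<close>

lemma exp_step:
  fixes N a j :: nat
  assumes "x = a ^ ((N - 1) div 2 ^ Suc j) mod N" and "1 \<le> a"
  shows "(x * x mod N) * ((a - 1) * ((N - 1) div 2 ^ j mod 2) + 1) mod N = a ^ ((N - 1) div 2 ^ j) mod N"
proof -
  define e where "e = (N - 1) div 2 ^ j"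
  have e2: "(N - 1) div 2 ^ Suc j = e div 2" 
    unfolding e_def power_Suc2 by (rule div_mult2_eq)
  have "(a - 1) * (e mod 2) + 1 = a ^ (e mod 2)"
    using assms(2) by (cases "even e") (auto simp: odd_iff_mod_2_eq_one)
  moreover have "a ^ e = a ^ (e div 2) * a ^ (e div 2) * a ^ (e mod 2)"
    by (metis div_mult_mod_eq mult_2_right power_add)
  ultimately show ?thesis unfolding assms(1) e2 e_def[symmetric]
    by (metis mod_mult_left_eq mod_mult_eq)
qed

lemma no_root_large:
  assumes "N - 1 < 2 ^ Suc i"
  shows "no_root N a i"
  using assms by (simp add: no_root_def)

definition mr_ok :: "nat \<Rightarrow> nat \<Rightarrow> bool" where
  "mr_ok N r \<longleftrightarrow> r mod N = 0 \<or> mr_pass N (r mod N)"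

definition try_pmf :: "nat pmf \<Rightarrow> nat set \<Rightarrow> (nat \<Rightarrow> bool pmf) \<Rightarrow> nat set \<Rightarrow> nat option pmf" where
  "try_pmf U A T S = bind_pmf U (\<lambda>x. if x \<in> A \<and> x \<notin> S
     then map_pmf (\<lambda>f. if f then Some x else None) (T x) else return_pmf None)"

primrec slot_pmf :: "(nat set \<Rightarrow> nat option pmf) \<Rightarrow> nat \<Rightarrow> nat set \<Rightarrow> nat option pmf" where
  "slot_pmf D 0 S = return_pmf None"
| "slot_pmf D (Suc t) S = bind_pmf (D S) (\<lambda>r. case r of None \<Rightarrow> slot_pmf D t S | Some x \<Rightarrow> return_pmf (Some x))"

definition append_pmf :: "(nat set \<Rightarrow> nat option pmf) \<Rightarrow> nat list \<Rightarrow> nat list pmf" where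
  "append_pmf D xs = map_pmf (\<lambda>r. case r of None \<Rightarrow> xs | Some x \<Rightarrow> xs @ [x]) (D (set xs))"

section \<open>Coupling of the subprograms with their distributions\<close>

locale sampler =
  fixes n k c1 c2 :: nat
  assumes n16: "16 \<le> n" and k_pos: "1 \<le> k" and k_le: "k \<le> n"
begin

definition "L = bits n"
text \<open>The part \<open>4 * L\<close> holds products of two numbers up to \<open>4 ^ L\<close>;
  \<open>c1\<close> and \<open>c2\<close> make room for the loop counters, as
  \<open>c \<le> 2 ^ c\<close>; the final 1 makes the bounds strict.\<close>

definition "B = 4 * L + c1 + c2 + 1"

sublocale ram_bounds B "n\<^sup>2" k
  by unfold_locales (simp add: B_def)

lemma n_less: "n < 2 ^ L" and le_n: "2 ^ (L - 1) \<le> n"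
  using floorlog_bounds[of n 2] n16 by (auto simp: L_def)

lemma L_pos: "5 \<le> L"
  unfolding L_def by (rule floorlog_geI) (use n16 in auto)

lemma n2_less: "n\<^sup>2 < 4 ^ L"
proof -
  have "n\<^sup>2 < (2 ^ L)\<^sup>2" using n_less by (intro power_strict_mono) auto
  also have "(2 ^ L)\<^sup>2 = (4::nat) ^ L" 
    unfolding power2_eq_square power_mult_distrib[symmetric] by simp
  finally show ?thesis .
qed

lemma word_bound: "v \<le> 4 ^ L * 4 ^ L \<Longrightarrow> v < 2 ^ B" for v :: nat
proof -
  assume "v \<le> 4 ^ L * 4 ^ L"
  also have "4 ^ L * 4 ^ L = (2::nat) ^ (4 * L)" 
    unfolding power_mult power_mult_distrib[symmetric] by simp
  also have "\<dots> < 2 ^ B" unfolding B_def by (intro power_strict_increasing) auto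
  finally show ?thesis .
qed

lemma word_bound1: "v \<le> 4 ^ L \<Longrightarrow> v < 2 ^ B" for v :: nat
proof (rule word_bound)
  have "4 ^ L * 1 \<le> 4 ^ L * (4 ^ L :: nat)" by (intro mult_le_mono) auto
  then show "v \<le> 4 ^ L * 4 ^ L" if "v \<le> 4 ^ L" using that by linarith
qed

lemma word_bound2: "v \<le> 2 * 4 ^ L \<Longrightarrow> v < 2 ^ B" for v :: nat
proof (rule word_bound)
  have "2 * 4 ^ L \<le> 4 ^ L * (4 ^ L :: nat)"
    using L_pos self_le_power[of "4::nat" L] by (intro mult_le_mono1) linarith
  then show "v \<le> 4 ^ L * 4 ^ L" if "v \<le> 2 * 4 ^ L" using that by linarith
qed

lemma sample_spec:
  assumes r: "r = 4 \<or> r = 6" and M: "M 14 = 2" "M 15 = 4 ^ L"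
  shows "exec_rel (sample r) (12 * L + 10) M xs (pmf_of_set {..<2 * 4 ^ L})
    (\<lambda>v M' xs'. xs' = xs \<and> M' r = v \<and> v < 2 * 4 ^ L \<and> (\<forall>q. q \<notin> {r, 8, 9} \<longrightarrow> M' q = M q))"
proof -
  define m where "m = Suc (2 * L)"
  have m: "(2 :: nat) ^ m = 2 * 4 ^ L" by (simp add: m_def power_mult)
  \<comment> \<open>\<open>j\<close> bits remain to be drawn; \<open>2 ^ j div 2\<close> is nonzero
    for all \<open>j > 0\<close> and 0 at the end. The bound on \<open>Suc x\<close> keeps every
    completion of the prefix below \<open>2 ^ m\<close>.\<close>
  define Inv where "Inv = (\<lambda>j x M' xs'. xs' = xs \<and> M' 8 = 2 ^ j div 2 \<and> M' r = x \<and> Suc x * 2 ^ j \<le> 2 ^ m \<and>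
    (\<forall>q. q \<notin> {r, 8, 9} \<longrightarrow> M' q = M q))"
  let ?body = "Seq (Instr (Coin 9)) (block [Add r r r, Add r r 9, Div 8 8 14] skip)"
  have "exec_rel (While_Nonzero 8 ?body) (m * (1 + 5) + 1) (fold det_mem [Const r 0, Copy 8 15] M) xs
    (iter_pmf (\<lambda>_ x. map_pmf (\<lambda>b. 2 * x + of_bool b) (bernoulli_pmf (1/2))) m 0) (\<lambda>a'. Inv 0 a')"
  proof (rule exec_rel_for[where Inv = Inv])
    show "Inv m 0 (fold det_mem [Const r 0, Copy 8 15] M) xs"
      using r M by (auto simp: Inv_def m)
    show "M 8 = 0" if "Inv 0 a M xs" for a M xs using that by (simp add: Inv_def)
    fix j x M' xs' assume I: "Inv (Suc j) x M' xs'" and g: "good M' xs'"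
    have x: "M' r = x" and M8: "M' 8 = 2 ^ j" and xb: "Suc x * 2 ^ Suc j \<le> 2 ^ m" and M14: "M' 14 = 2"
      using I r M by (auto simp: Inv_def)
    have "Suc x * 2 \<le> Suc x * 2 ^ Suc j" by (intro mult_le_mono) auto
    also note xb
    finally have xs2: "2 * x + 2 \<le> 2 * 4 ^ L" by (simp add: m)
    have pj: "(2::nat) ^ j \<le> 4 ^ L" 
    proof -
      have "1 * 2 ^ Suc j \<le> Suc x * 2 ^ Suc j" by (intro mult_le_mono) auto
      then show ?thesis using xb m by simp
    qed
    have "exec_rel ?body (1 + (length [Add r r r, Add r r 9, Div 8 8 14] + 1)) M' xs'
      (bind_pmf (bernoulli_pmf (1/2)) (\<lambda>b. return_pmf (2 * x + of_bool b))) (\<lambda>a'. Inv j a')"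
    proof (rule exec_rel_Seq[OF exec_rel_coin], goal_cases)
      case (2 b M2 xs2)
      then have M2: "M2 = M'(9 := of_bool b)" "xs2 = xs'" by auto
      show ?case
      proof (rule exec_rel_block)
        show "safe [Add r r r, Add r r 9, Div 8 8 14] M2 xs2"
          using r g x M8 M14 xs2 pj unfolding M2
          by (auto intro!: good_upd word_bound2 simp: one_less_word)
        show "exec_rel skip 1 (fold det_mem [Add r r r, Add r r 9, Div 8 8 14] M2) xs2 (return_pmf (2 * x + of_bool b)) (\<lambda>a'. Inv j a')"
          using r I x M8 M14 xb unfolding M2
          by (intro exec_rel_skip) (auto simp: Inv_def algebra_simps)
      qed
    qed simp
    then show "M' 8 \<noteq> 0 \<and> exec_rel ?body 5 M' xs'
      (map_pmf (\<lambda>b. 2 * x + of_bool b) (bernoulli_pmf (1/2))) (\<lambda>a'. Inv j a')"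
      using M8 by (auto simp: map_pmf_def intro: exec_rel_time)
  qed
  then have "exec_rel (sample r) (length [Const r 0, Copy 8 15] + (m * (1 + 5) + 1)) M xs
      (iter_pmf (\<lambda>_ x. map_pmf (\<lambda>b. 2 * x + of_bool b) (bernoulli_pmf (1/2))) m 0) (\<lambda>a'. Inv 0 a')"
    unfolding sample_def
    using r M by (intro exec_rel_block) (auto intro!: good_upd word_bound1)
  moreover have "{0 * 2 ^ m..<Suc 0 * 2 ^ m} = {..<2 * 4 ^ L :: nat}" by (auto simp: m)
  ultimately have "exec_rel (sample r) (length [Const r 0, Copy 8 15] + (m * (1 + 5) + 1)) M xs
      (pmf_of_set {..<2 * 4 ^ L}) (\<lambda>a'. Inv 0 a')"
    unfolding iter_pmf_coin by (simp only:)
  then show ?thesis by (rule exec_rel_conseq) (simp add: m_def, auto simp: Inv_def m)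
qed

lemma mr_loop_spec:
  assumes M: "M 13 = 1" "M 14 = 2" "M 4 = N" "M 6 = a" "M 7 = of_bool f" "M 8 = 4 ^ L" "M 10 = 1"
    and N: "2 \<le> N" "N \<le> n\<^sup>2" and a: "1 \<le> a" "a \<le> N"
  shows "exec_rel mr_loop (48 * L + 25) M xs (return_pmf ())
    (\<lambda>_ M' xs'. xs' = xs \<and> M' 10 = a ^ (N - 1) mod N \<and> M' 7 = of_bool (f \<and> (\<forall>i. no_root N a i)) \<and>
       (\<forall>q. q \<notin> {7, 8, 9, 10, 11, 12} \<longrightarrow> M' q = M q))"
proof -
  define m where "m = Suc (2 * L)"
  have m: "(2 :: nat) ^ m = 2 * 4 ^ L" by (simp add: m_def power_mult)
  have N4: "N < 4 ^ L" using N n2_less by linarith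
  \<comment> \<open>\<open>j\<close> bits of the exponent remain to be read: the running power
    belongs to the prefix \<open>(N - 1) div 2 ^ j\<close>, and the root conditions from index
    \<open>j\<close> on have been checked.\<close>
  define Inv where "Inv = (\<lambda>j (_::unit) M' xs'. j \<le> m \<and> xs' = xs \<and> M' 8 = 2 ^ j div 2 \<and>
    M' 10 = a ^ ((N - 1) div 2 ^ j) mod N \<and> M' 7 = of_bool (f \<and> (\<forall>i\<ge>j. no_root N a i)) \<and>
    (\<forall>q. q \<notin> {7, 8, 9, 10, 11, 12} \<longrightarrow> M' q = M q))"
  let ?is = "[Mul 9 10 10, instr.Mod 9 9 4,
      Sub 11 9 13, Sub 12 13 9, Add 11 11 12, Sub 11 13 11,
      Sub 12 10 13, Mul 11 11 12, Sub 12 4 13, Sub 12 12 10, Mul 11 11 12,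
      Sub 11 13 11, Mul 7 7 11,
      Sub 12 4 13, Div 12 12 8, instr.Mod 12 12 14,
      Sub 11 6 13, Mul 11 11 12, Add 11 11 13,
      Mul 10 9 11, instr.Mod 10 10 4, Div 8 8 14]"
  have "exec_rel mr_loop (m * (1 + 23) + 1) M xs (iter_pmf (\<lambda>_ _. return_pmf ()) m ()) (\<lambda>a'. Inv 0 a')"
    unfolding mr_loop_def
  proof (rule exec_rel_for[where Inv = Inv])
    \<comment> \<open>The loop starts with the empty prefix: the exponent is 0, the running power 1,
      and the conditions from \<open>m\<close> on hold trivially.\<close>
    have "N - 1 < 2 ^ m" using N4 m by linarith
    moreover from this have "no_root N a i" if "m \<le> i" for i
      by (intro no_root_large) (use that power_increasing[of m "Suc i" "2::nat"] in linarith)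
    ultimately show "Inv m () M xs" using M N m by (auto simp: Inv_def)
    show "M 8 = 0" if "Inv 0 a M xs" for a M xs using that by (simp add: Inv_def)
    fix j and e :: unit and M' xs' assume I: "Inv (Suc j) e M' xs'" and g: "good M' xs'"
    define x where "x = M' 10"
    define y where "y = x * x mod N"
    define F where "F = M' 7"
    have M': "M' 13 = 1" "M' 14 = 2" "M' 4 = N" "M' 6 = a" "M' 8 = 2 ^ j"
      using I M by (auto simp: Inv_def)
    have xe: "x = a ^ ((N - 1) div 2 ^ Suc j) mod N" using I by (simp add: Inv_def x_def)
    have xN: "x < N" "y < N" using xe N by (auto simp: y_def)
    have F: "F = of_bool (f \<and> (\<forall>i\<ge>Suc j. no_root N a i))" using I by (simp add: Inv_def F_def)
    have "(2::nat) ^ j \<le> 4 ^ L"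
      using I power_increasing[of "Suc j" m "2::nat"] by (auto simp: Inv_def m)
    note pj = this
    define u where "u = 1 - (y - 1 + (1 - y))"
    have nr: "1 - u * (x - 1) * (N - 1 - x) = of_bool (no_root N a j)"
      unfolding u_def by (rule no_root_arith[OF N(1) xe y_def])
    have ex: "y * ((a - 1) * ((N - 1) div 2 ^ j mod 2) + 1) mod N = a ^ ((N - 1) div 2 ^ j) mod N"
      unfolding y_def by (rule exp_step[OF xe a(1)])
    have all: "(\<forall>i\<ge>j. no_root N a i) \<longleftrightarrow> no_root N a j \<and> (\<forall>i\<ge>Suc j. no_root N a i)"
      by (auto simp: le_eq_less_or_eq[of j] Suc_le_eq)
    have sq: "v < 2 ^ B" if "v \<le> N * N" for v :: nat
    proof (rule word_bound)
      have "N * N \<le> 4 ^ L * 4 ^ L" using N4 by (intro mult_le_mono) auto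
      then show "v \<le> 4 ^ L * 4 ^ L" using that by linarith
    qed
    have lin: "v < 2 ^ B" if "v \<le> N" for v :: nat using that N4 by (intro word_bound1) linarith
    have u1: "u \<le> 1" by (simp add: u_def)
    have bit: "(N - 1) div 2 ^ j mod 2 \<le> 1" by linarith
    have f0: "fold det_mem ?is M' = M'(7 := F * of_bool (no_root N a j),
        8 := 2 ^ j div 2, 9 := y, 10 := a ^ ((N - 1) div 2 ^ j) mod N,
        11 := (a - 1) * ((N - 1) div 2 ^ j mod 2) + 1, 12 := (N - 1) div 2 ^ j mod 2)"
      unfolding nr[symmetric] ex[symmetric] 
      by (simp add: M' x_def[symmetric] y_def u_def F_def fun_eq_iff)
    define v where "v = u * (x - 1)"
    define w where "w = v * (N - 1 - x)"
    define b where "b = (N - 1) div 2 ^ j mod 2"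
    define h where "h = (a - 1) * b"
    have v: "v \<le> N" using mult_le_mono[OF u1, of "x - 1" N] xN by (simp add: v_def)
    have w: "w \<le> N * N" unfolding w_def using v by (intro mult_le_mono) auto
    have h: "h \<le> N - 1" using mult_le_mono[of "a - 1" "N - 1" b 1] a bit by (simp add: h_def b_def)
    have bounds: "x * x < 2 ^ B" "y < 2 ^ B" "y - Suc 0 < 2 ^ B" "Suc 0 - y < 2 ^ B"
      "y - Suc 0 + (Suc 0 - y) < 2 ^ B" "u < 2 ^ B" "x - Suc 0 < 2 ^ B" "v < 2 ^ B"
      "N - Suc 0 < 2 ^ B" "N - Suc x < 2 ^ B" "w < 2 ^ B" "Suc 0 - w < 2 ^ B" "F * (Suc 0 - w) < 2 ^ B"
      "(N - Suc 0) div 2 ^ j < 2 ^ B" "b < 2 ^ B" "a - Suc 0 < 2 ^ B" "h < 2 ^ B" "Suc h < 2 ^ B"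
      "y + y * h < 2 ^ B" "(y + y * h) mod N < 2 ^ B" "2 ^ j div 2 < (2::nat) ^ B"
    proof -
      have "x * x \<le> N * N" "y * Suc h \<le> N * N" using xN h N by (intro mult_le_mono; linarith)+
      then show "x * x < 2 ^ B" "y + y * h < 2 ^ B" using sq[of "x * x"] sq[of "y * Suc h"] by simp_all
      show "w < 2 ^ B" using w by (rule sq)
      have "(N - Suc 0) div 2 ^ j \<le> N - Suc 0" by simp
      then show "(N - Suc 0) div 2 ^ j < 2 ^ B" by (intro lin) linarith
      have "F * (Suc 0 - w) \<le> 1 * 1" by (intro mult_le_mono) (auto simp: F)
      then show "F * (Suc 0 - w) < 2 ^ B" using N by (intro lin) linarith
      have "(y + y * h) mod N < N" using N by simp
      then show "(y + y * h) mod N < 2 ^ B" by (intro lin) linarith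
      show "2 ^ j div 2 < (2::nat) ^ B" using pj by (intro word_bound1) linarith
      show "y < 2 ^ B" "y - Suc 0 < 2 ^ B" "Suc 0 - y < 2 ^ B"
        "y - Suc 0 + (Suc 0 - y) < 2 ^ B" "u < 2 ^ B" "x - Suc 0 < 2 ^ B" "v < 2 ^ B"
        "N - Suc 0 < 2 ^ B" "N - Suc x < 2 ^ B" "Suc 0 - w < 2 ^ B"
        "b < 2 ^ B" "a - Suc 0 < 2 ^ B" "h < 2 ^ B" "Suc h < 2 ^ B"
        using xN u1 v h N bit a unfolding b_def by (intro lin; linarith)+
    qed
    have folds: "x * x mod N = y" "Suc 0 - (y - Suc 0 + (Suc 0 - y)) = u" "u * (x - Suc 0) = v"
      "v * (N - Suc x) = w" "(N - Suc 0) div 2 ^ j mod 2 = b" "(a - Suc 0) * b = h"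
      by (simp_all add: y_def u_def v_def w_def b_def h_def)
    have "safe ?is M' xs'"
      by (simp add: M' x_def[symmetric] F_def[symmetric] folds) (intro conjI good_upd g; simp add: bounds)
    have "exec_rel (block ?is skip) (length ?is + 1) M' xs' (return_pmf ()) (\<lambda>a'. Inv j a')"
    proof (rule exec_rel_block)
      show "safe ?is M' xs'" by fact
      show "exec_rel skip 1 (fold det_mem ?is M') xs' (return_pmf ()) (\<lambda>a'. Inv j a')"
        unfolding f0 using I F all by (intro exec_rel_skip) (auto simp: Inv_def)
    qed
    then show "M' 8 \<noteq> 0 \<and> exec_rel (block ?is skip) 23 M' xs' (return_pmf ()) (\<lambda>a'. Inv j a')"
      using M' by (auto intro: exec_rel_time)
  qed
  then show ?thesis unfolding iter_pmf_return
    by (rule exec_rel_conseq) (auto simp: m_def Inv_def)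
qed

definition "coins = pmf_of_set {..<2 * 4 ^ L :: nat}"

definition "test_pmf N = iter_pmf (\<lambda>_ f. map_pmf (\<lambda>r. f \<and> mr_ok N r) coins) (c1 * L) True"

definition "round_time = 60 * L + 46"

lemma mr_round_spec:
  assumes M: "M 13 = 1" "M 14 = 2" "M 15 = 4 ^ L" "M 4 = N" "M 7 = of_bool f"
    and N: "2 \<le> N" "N \<le> n\<^sup>2"
  shows "exec_rel mr_round round_time M xs (map_pmf (\<lambda>r. f \<and> mr_ok N r) coins)
    (\<lambda>f' M' xs'. xs' = xs \<and> M' 7 = of_bool f' \<and> (\<forall>q. q \<notin> {6, 7, 8, 9, 10, 11, 12} \<longrightarrow> M' q = M q))"
    (is "exec_rel _ _ _ _ _ ?Q")
proof -
  have N4: "N < 4 ^ L" using N n2_less by linarith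
  let ?is = "[instr.Mod 6 6 4, Sub 9 13 6, Add 6 6 9, Const 10 1, Copy 8 15]"
  let ?js = "[Sub 11 10 13, Sub 12 13 10, Add 11 11 12, Sub 11 13 11, Mul 7 7 11]"
  have "exec_rel mr_round ((12 * L + 10) + (length ?is + ((48 * L + 25) + (length ?js + 1)))) M xs
     (bind_pmf (pmf_of_set {..<2 * 4 ^ L}) (\<lambda>r. return_pmf (f \<and> mr_ok N r))) ?Q"
    unfolding mr_round_def
  proof (rule exec_rel_Seq[OF sample_spec], goal_cases)
    case (4 r M1 xs1)
    then have M1: "xs1 = xs" "M1 6 = r" "M1 13 = 1" "M1 14 = 2" "M1 15 = 4 ^ L" "M1 4 = N" "M1 7 = of_bool f"
      "\<And>q. q \<notin> {6, 8, 9} \<Longrightarrow> M1 q = M q" and g: "good M1 xs1"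
      using M by auto
    define a where "a = r mod N + (1 - r mod N)"
    have rN: "r mod N < N" using N by simp
    have a: "1 \<le> a" "a \<le> N" using rN N unfolding a_def by linarith+
    show ?case
    proof (rule exec_rel_block)
      show "safe ?is M1 xs1"
        using M1 by simp (intro conjI good_upd g[unfolded M1(1)] word_bound1; insert rN N4 N; linarith)
      let ?M2 = "fold det_mem ?is M1"
      have M2: "?M2 13 = 1" "?M2 14 = 2" "?M2 4 = N" "?M2 6 = a" "?M2 7 = of_bool f" "?M2 8 = 4 ^ L" "?M2 10 = 1"
        using M1 by (auto simp: a_def)
      show "exec_rel (Seq mr_loop (block ?js skip)) ((48 * L + 25) + (length ?js + 1)) ?M2 xs1
        (return_pmf (f \<and> mr_ok N r)) ?Q"
      proof (rule exec_rel_Seq_unit[OF mr_loop_spec[OF M2 N a]], goal_cases)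
        case (1 M3 xs3)
        define z where "z = a ^ (N - 1) mod N"
        have zN: "z < N" using N by (simp add: z_def)
        define F where "F = (f \<and> (\<forall>i. no_root N a i))"
        have M3: "xs3 = xs" "M3 10 = z" "M3 7 = of_bool F" "M3 13 = 1" and g3: "good M3 xs3"
          and fr: "\<And>q. q \<notin> {6, 7, 8, 9, 10, 11, 12} \<Longrightarrow> M3 q = M q"
          using 1 M1 by (auto simp: z_def F_def)
        have ok: "mr_ok N r \<longleftrightarrow> mr_pass N a"
        proof (cases "r mod N = 0")
          case True
          then show ?thesis using mr_pass_1[of N] by (simp add: mr_ok_def a_def)
        qed (simp add: mr_ok_def a_def)
        have "(f \<and> mr_ok N r) \<longleftrightarrow> F \<and> z = 1"
          unfolding ok mr_pass_iff[OF N(1)] z_def F_def by blast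
        then have flag: "of_bool F * (1 - (z - 1 + (1 - z))) = (of_bool (f \<and> mr_ok N r) :: nat)"
          by auto
        show ?case
        proof (rule exec_rel_block)
          show "safe ?js M3 xs3"
            using M3
            by (cases F; simp) (intro conjI good_upd g3[unfolded M3(1)] word_bound1; insert zN N4 N; linarith)+
          show "exec_rel skip 1 (fold det_mem ?js M3) xs3 (return_pmf (f \<and> mr_ok N r)) ?Q"
            using M3 fr flag by (intro exec_rel_skip) auto
        qed
      qed
    qed
  qed (use M in auto)
  then show ?thesis unfolding map_pmf_def coins_def
    by (rule exec_rel_time) (simp add: round_time_def)
qed

lemma word_bound_c: "c1 < 2 ^ B" "c1 * L < 2 ^ B" "c2 < 2 ^ B" "c2 * L < 2 ^ B" "c2 * L * L < 2 ^ B"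
proof -
  have pw: "x < 2 ^ B" if "x \<le> 2 ^ e" "e < B" for x e :: nat
    using that(1) power_strict_increasing[OF that(2), of "2 :: nat"] by linarith
  have c: "c1 \<le> 2 ^ c1" "c2 \<le> 2 ^ c2" "L \<le> 2 ^ L" using less_exp less_imp_le by blast+
  show "c1 < 2 ^ B" "c2 < 2 ^ B" by (rule pw[OF c(1)] pw[OF c(2)]; simp add: B_def)+
  show "c1 * L < 2 ^ B" "c2 * L < 2 ^ B" "c2 * L * L < 2 ^ B"
    by (rule pw[of _ "c1 + L"] pw[of _ "c2 + L"] pw[of _ "c2 + L + L"];
        use L_pos in \<open>simp add: power_add mult_le_mono c B_def\<close>)+
qed

definition "test_time = c1 * L * (round_time + 2) + 4"

lemma mr_test_spec:
  assumes M: "M 2 = L" "M 13 = 1" "M 14 = 2" "M 15 = 4 ^ L" "M 4 = N" 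
    and N: "2 \<le> N" "N \<le> n\<^sup>2"
  shows "exec_rel (mr_test c1) test_time M xs (test_pmf N)
    (\<lambda>f' M' xs'. xs' = xs \<and> M' 7 = of_bool f' \<and> (\<forall>q. q \<notin> {5, 6, 7, 8, 9, 10, 11, 12} \<longrightarrow> M' q = M q))"
proof -
  define Inv where "Inv = (\<lambda>j f M' xs'. xs' = xs \<and> M' 5 = j \<and> M' 7 = of_bool f \<and>
    (\<forall>q. q \<notin> {5, 6, 7, 8, 9, 10, 11, 12} \<longrightarrow> M' q = M q))"
  let ?is = "[Const 7 1, Const 9 c1, Mul 5 9 2]"
  have "exec_rel (mr_test c1) (length ?is + (c1 * L * (1 + (1 + round_time)) + 1)) M xs (test_pmf N) (\<lambda>a'. Inv 0 a')"
    unfolding mr_test_def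
  proof (rule exec_rel_block)
    show "safe ?is M xs" if "good M xs"
      using that M word_bound_c one_less_word by simp (intro conjI good_upd; simp)
    show "exec_rel (While_Nonzero 5 (block [Sub 5 5 13] mr_round)) (c1 * L * (1 + (1 + round_time)) + 1)
      (fold det_mem ?is M) xs (test_pmf N) (\<lambda>a'. Inv 0 a')"
      unfolding test_pmf_def
    proof (rule exec_rel_for[where Inv = Inv])
      show "Inv (c1 * L) True (fold det_mem ?is M) xs" using M by (auto simp: Inv_def)
      show "M 5 = 0" if "Inv 0 a M xs" for a M xs using that by (simp add: Inv_def)
      fix j f M' xs' assume I: "Inv (Suc j) f M' xs'" and g: "good M' xs'"
      have M13: "M' 13 = 1" using I M by (simp add: Inv_def)
      have "exec_rel (block [Sub 5 5 13] mr_round) (length [Sub 5 5 13] + round_time) M' xs'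
        (map_pmf (\<lambda>r. f \<and> mr_ok N r) coins) (\<lambda>a'. Inv j a')"
      proof (rule exec_rel_block)
        have "M' 5 < 2 ^ B" using g by (simp add: good_def)
        then have "j < 2 ^ B" using I by (simp add: Inv_def)
        then show "safe [Sub 5 5 13] M' xs'" using I M13 g by (simp add: Inv_def good_upd)
        show "exec_rel mr_round round_time (fold det_mem [Sub 5 5 13] M') xs'
           (map_pmf (\<lambda>r. f \<and> mr_ok N r) coins) (\<lambda>a'. Inv j a')"
          by (rule exec_rel_conseq[OF mr_round_spec[where N = N]]) (use I M N in \<open>auto simp: Inv_def\<close>)
      qed
      then show "M' 5 \<noteq> 0 \<and> exec_rel (block [Sub 5 5 13] mr_round) (1 + round_time) M' xs'
        (map_pmf (\<lambda>r. f \<and> mr_ok N r) coins) (\<lambda>a'. Inv j a')"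
        using I by (simp add: Inv_def)
    qed
  qed
  then show ?thesis by (rule exec_rel_conseq) (auto simp: test_time_def Inv_def algebra_simps)
qed

definition "cand_pmf = try_pmf coins {n..n\<^sup>2} test_pmf"

definition "slot = slot_pmf cand_pmf (c2 * L * L)"

text \<open>Supplies the converse of the dictionary clause in \<open>good\<close>: every number
  output has its register set. Together they make a lookup decide membership;
  \<open>16 \<le> x\<close> keeps the dictionary clear of the working registers.\<close>

definition ready :: "(nat \<Rightarrow> nat) \<Rightarrow> nat list \<Rightarrow> bool" where
  "ready M xs \<longleftrightarrow> M 0 = n \<and> M 2 = L \<and> M 13 = 1 \<and> M 14 = 2 \<and> M 15 = 4 ^ L \<and> (\<forall>x\<in>set xs. 16 \<le> x \<and> M x \<noteq> 0)"

definition "try_time = test_time + 12 * L + 30"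

lemma try_spec:
  assumes S: "ready M xs" and len: "length xs < k"
  shows "exec_rel (try_prog c1) try_time M xs (cand_pmf (set xs))
    (\<lambda>r M' xs'. ready M' xs' \<and> M' 1 = M 1 \<and>
       (case r of None \<Rightarrow> xs' = xs \<and> M' 3 = M 3 | Some x \<Rightarrow> xs' = xs @ [x] \<and> M' 3 = 0))"
    (is "exec_rel _ _ _ _ _ ?Q")
proof -
  let ?is = "[Mul 9 0 0, Sub 11 4 9, Sub 12 0 4, Add 11 11 12]"
  let ?T = "\<lambda>x. if x \<in> {n..n\<^sup>2} \<and> x \<notin> set xs
     then map_pmf (\<lambda>f. if f then Some x else None) (test_pmf x) else return_pmf None"
  have "exec_rel (try_prog c1) ((12 * L + 10) + (length ?is + (1 + (length [Load 7 4] + (1 + (test_time + (1 + 4))))))) M xs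
    (bind_pmf (pmf_of_set {..<2 * 4 ^ L}) ?T) ?Q"
    unfolding try_prog_def
  proof (rule exec_rel_Seq[OF sample_spec], goal_cases)
    case (4 x M1 xs1)
    then have M1: "xs1 = xs" "M1 4 = x" "M1 0 = n" "x < 2 * 4 ^ L"
      and fr1: "\<And>q. q \<notin> {4, 8, 9} \<Longrightarrow> M1 q = M q" and g: "good M1 xs1"
      using S by (auto simp: ready_def)
    have "n \<le> n * n" by simp
    moreover have "n * n < 4 ^ L" using n2_less by (simp add: power2_eq_square)
    ultimately have nn: "n \<le> 4 ^ L" "n * n \<le> 4 ^ L" by linarith+
    show ?case
    proof (rule exec_rel_block)
      show "safe ?is M1 xs1"
        using M1 nn by simp (intro conjI good_upd g[unfolded M1(1)] word_bound2; linarith)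
      define M2 where "M2 = fold det_mem ?is M1"
      have M2: "M2 4 = x" "M2 11 = (x - n * n) + (n - x)" and fr2: "\<And>q. q \<notin> {4, 8, 9, 11, 12} \<Longrightarrow> M2 q = M q"
        using M1 fr1 by (auto simp: M2_def)
      let ?Q3 = "If_Nonzero 7 (Seq (Instr (Emit 4)) (block [Store 4 13, Const 3 0] skip)) skip"
      have M2_0: "M2 11 = 0 \<longleftrightarrow> x \<in> {n..n\<^sup>2}" unfolding M2(2) by (auto simp: power2_eq_square)
      have ready2: "ready M2 xs" using S fr2 by (fastforce simp: ready_def)
      have "exec_rel (If_Nonzero 11 skip (block [Load 7 4] (If_Nonzero 7 skip (Seq (mr_test c1) ?Q3))))
        (1 + (length [Load 7 4] + (1 + (test_time + (1 + 4))))) M2 xs (?T x) ?Q"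
      proof (rule exec_rel_If)
        assume "M2 11 \<noteq> 0"
        then have "x \<notin> {n..n\<^sup>2}" using M2_0 by simp
        then have T: "?T x = return_pmf None" by (metis (no_types, lifting))
        have "exec_rel skip 1 M2 xs (return_pmf None) ?Q"
          using ready2 fr2[of 1] fr2[of 3] by (intro exec_rel_skip) auto
        then show "exec_rel skip (length [Load 7 4] + (1 + (test_time + (1 + 4)))) M2 xs (?T x) ?Q"
          unfolding T by (rule exec_rel_time) simp
      next
        assume "M2 11 = 0"
        then have x: "x \<in> {n..n\<^sup>2}" using M2_0 by simp
        then have x16: "16 \<le> x" using n16 by simp
        show "exec_rel (block [Load 7 4] (If_Nonzero 7 skip (Seq (mr_test c1) ?Q3)))
          (length [Load 7 4] + (1 + (test_time + (1 + 4)))) M2 xs (?T x) ?Q"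
        proof (rule exec_rel_good, rule exec_rel_block)
          assume g2: "good M2 xs"
          have seen: "M2 x \<noteq> 0 \<longleftrightarrow> x \<in> set xs"
            using g2 ready2 x16 unfolding good_def ready_def by blast
          have "M2 x < 2 ^ B" using g2 x16 one_less_word unfolding good_def
            by (metis One_nat_def gr0I less_trans zero_less_one)
          then show "safe [Load 7 4] M2 xs" using M2(1) g2 by (simp add: good_upd)
          define M3 where "M3 = M2(7 := M2 x)"
          have M3_eq: "fold det_mem [Load 7 4] M2 = M3" using M2(1) by (simp add: M3_def)
          have M3: "M3 4 = x" "M3 7 = M2 x" and fr3: "\<And>q. q \<notin> {4, 7, 8, 9, 11, 12} \<Longrightarrow> M3 q = M q"
            using M2 fr2 by (auto simp: M3_def)
          have ready3: "ready M3 xs" using S fr3 by (fastforce simp: ready_def)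
          show "exec_rel (If_Nonzero 7 skip (Seq (mr_test c1) ?Q3)) (1 + (test_time + (1 + 4)))
             (fold det_mem [Load 7 4] M2) xs (?T x) ?Q"
            unfolding M3_eq
          proof (rule exec_rel_If)
            assume "M3 7 \<noteq> 0"
            then have T: "?T x = return_pmf None" using M3 seen by simp
            have "exec_rel skip 1 M3 xs (return_pmf None) ?Q"
              using ready3 fr3[of 1] fr3[of 3] by (intro exec_rel_skip) auto
            then show "exec_rel skip (test_time + (1 + 4)) M3 xs (?T x) ?Q"
              unfolding T by (rule exec_rel_time) simp
          next
            assume "M3 7 = 0"
            then have T: "?T x = bind_pmf (test_pmf x) (\<lambda>f. return_pmf (if f then Some x else None))"
              using M3 seen x by (simp add: map_pmf_def)
            show "exec_rel (Seq (mr_test c1) ?Q3) (test_time + (1 + 4)) M3 xs (?T x) ?Q"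
              unfolding T
            proof (rule exec_rel_Seq[OF mr_test_spec[where N = x]], goal_cases)
              case (8 f M4 xs4)
              then have M4: "xs4 = xs" "M4 7 = of_bool f" and g4: "good M4 xs"
                and fr4: "\<And>q. q \<notin> {5, 6, 7, 8, 9, 10, 11, 12} \<Longrightarrow> M4 q = M3 q" by auto
              have ready4: "ready M4 xs" using ready3 fr4 by (fastforce simp: ready_def)
              have M4': "M4 4 = x" "M4 13 = 1" "M4 1 = M 1" "M4 3 = M 3"
                using fr4 M3 fr3 S by (auto simp: ready_def)
              show ?case unfolding M4(1)
              proof (rule exec_rel_If)
                assume "M4 7 = 0"
                then have "\<not> f" using M4 by auto
                then have "exec_rel skip 1 M4 xs (return_pmf (if f then Some x else None)) ?Q"
                  using ready4 M4' by (intro exec_rel_skip) auto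
                then show "exec_rel skip 4 M4 xs (return_pmf (if f then Some x else None)) ?Q"
                  by (rule exec_rel_time) simp
              next
                assume "M4 7 \<noteq> 0"
                then have f: "f" using M4 by auto
                have "exec_rel (Seq (Instr (Emit 4)) (block [Store 4 13, Const 3 0] skip)) (1 + (length [Store 4 13, Const 3 0] + 1))
                  M4 xs (return_pmf (Some x)) ?Q"
                proof (rule exec_rel_Seq_unit[where R = "\<lambda>_ M' xs'. M' = M4 \<and> xs' = xs @ [x]"])
                  show "exec_rel (Instr (Emit 4)) 1 M4 xs (return_pmf ()) (\<lambda>_ M' xs'. M' = M4 \<and> xs' = xs @ [x])"
                    using M4' x len by (intro exec_rel_emit) auto
                  fix M5 xs5 assume "M5 = M4 \<and> xs5 = xs @ [x]" and g5: "good M5 xs5"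
                  then have M5: "M5 = M4" "xs5 = xs @ [x]" by auto
                  show "exec_rel (block [Store 4 13, Const 3 0] skip) (length [Store 4 13, Const 3 0] + 1) M5 xs5 (return_pmf (Some x)) ?Q"
                    unfolding M5
                  proof (rule exec_rel_block)
                    \<comment> \<open>Between \<open>Emit\<close> and \<open>Store\<close> the
                      number is in the output but not in the dictionary; \<open>good\<close> allows
                      this, and \<open>ready\<close> is restored only now.\<close>
                    have "good (M4(x := 1)) (xs @ [x])"
                      using g5 x16 unfolding M5 good_def by auto
                    then show "safe [Store 4 13, Const 3 0] M4 (xs @ [x])"
                      using M4' by (auto intro!: good_upd)
                    show "exec_rel skip 1 (fold det_mem [Store 4 13, Const 3 0] M4) (xs @ [x]) (return_pmf (Some x)) ?Q"
                      using M4' ready4 x16 by (intro exec_rel_skip) (auto simp: ready_def)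
                  qed
                qed
                then show "exec_rel (Seq (Instr (Emit 4)) (block [Store 4 13, Const 3 0] skip)) 4
                  M4 xs (return_pmf (if f then Some x else None)) ?Q" using f by (auto intro: exec_rel_time)
              qed
            qed (use ready3 M3 x x16 in \<open>auto simp: ready_def\<close>)
          qed
        qed
      qed
      then show "exec_rel (If_Nonzero 11 skip (block [Load 7 4] (If_Nonzero 7 skip (Seq (mr_test c1) ?Q3))))
        (1 + (length [Load 7 4] + (1 + (test_time + (1 + 4))))) (fold det_mem ?is M1) xs1 (?T x) ?Q"
        unfolding M1(1) M2_def .
    qed
  qed (use S in \<open>auto simp: ready_def\<close>)
  then show ?thesis unfolding cand_pmf_def try_pmf_def coins_def
    by (rule exec_rel_time) (simp add: try_time_def)
qed

definition "slot_time = c2 * L * L * (try_time + 2) + 4"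

text \<open>A success clears the counter and leaves the loop early, so the rule for counted loops
  does not fit; the induction follows \<open>slot_pmf\<close> instead, and the time bound is that of
  all \<open>t\<close> tries.\<close>

lemma try_loop_spec:
  assumes "ready M xs" "length xs < k" "M 3 = t"
  shows "exec_rel (While_Nonzero 3 (block [Sub 3 3 13] (try_prog c1))) (t * (try_time + 2) + 1) M xs
    (slot_pmf cand_pmf t (set xs))
    (\<lambda>r M' xs'. ready M' xs' \<and> M' 1 = M 1 \<and> xs' = (case r of None \<Rightarrow> xs | Some x \<Rightarrow> xs @ [x]))"
  using assms
proof (induction t arbitrary: M)
  case 0
  then show ?case unfolding slot_pmf.simps mult_0 add_0 by (intro exec_rel_while_0) auto
next
  case (Suc t)
  let ?W = "While_Nonzero 3 (block [Sub 3 3 13] (try_prog c1))"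
  let ?Q = "\<lambda>r M' xs'. ready M' xs' \<and> M' 1 = M 1 \<and> xs' = (case r of None \<Rightarrow> xs | Some x \<Rightarrow> xs @ [x])"
  let ?R = "\<lambda>r M' xs'. ready M' xs' \<and> M' 1 = M 1 \<and>
       (case r of None \<Rightarrow> xs' = xs \<and> M' 3 = t | Some x \<Rightarrow> xs' = xs @ [x] \<and> M' 3 = 0)"
  have M13: "M 13 = 1" using Suc.prems by (simp add: ready_def)
  have "exec_rel ?W (1 + (length [Sub 3 3 13] + try_time) + (t * (try_time + 2) + 1)) M xs (slot_pmf cand_pmf (Suc t) (set xs)) ?Q"
    unfolding slot_pmf.simps
  proof (rule exec_rel_while_step[where R = ?R])
    show "M 3 \<noteq> 0" using Suc.prems by simp
    show "exec_rel (block [Sub 3 3 13] (try_prog c1)) (length [Sub 3 3 13] + try_time) M xs (cand_pmf (set xs)) ?R"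
    proof (rule exec_rel_block)
      assume g: "good M xs"
      then have "M 3 < 2 ^ B" by (simp add: good_def)
      then show "safe [Sub 3 3 13] M xs" using Suc.prems M13 g by (simp add: good_upd)
    next
      have "ready (fold det_mem [Sub 3 3 13] M) xs" using Suc.prems by (fastforce simp: ready_def)
      from try_spec[OF this Suc.prems(2)]
      show "exec_rel (try_prog c1) try_time (fold det_mem [Sub 3 3 13] M) xs (cand_pmf (set xs)) ?R"
        by (rule exec_rel_conseq) (use Suc.prems M13 in \<open>auto split: option.splits\<close>)
    qed
    fix r M' xs' assume R: "?R r M' xs'"
    show "exec_rel ?W (t * (try_time + 2) + 1) M' xs'
       (case r of None \<Rightarrow> slot_pmf cand_pmf t (set xs) | Some x \<Rightarrow> return_pmf (Some x)) ?Q"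
    proof (cases r)
      case None
      then show ?thesis using Suc.IH[of M'] Suc.prems R by auto
    next
      case (Some x)
      have "exec_rel ?W 1 M' xs' (return_pmf (Some x)) ?Q"
        using R Some by (intro exec_rel_while_0) auto
      then show ?thesis unfolding Some option.case by (rule exec_rel_time) simp
    qed
  qed
  then show ?case by (rule exec_rel_time) simp
qed

lemma slot_spec:
  assumes "ready M xs" "length xs < k"
  shows "exec_rel (slot_prog c1 c2) slot_time M xs (slot (set xs))
    (\<lambda>r M' xs'. ready M' xs' \<and> M' 1 = M 1 \<and> xs' = (case r of None \<Rightarrow> xs | Some x \<Rightarrow> xs @ [x]))"
    (is "exec_rel _ _ _ _ _ ?Q")
proof -
  let ?is = "[Const 9 c2, Mul 3 9 2, Mul 3 3 2]"
  have "exec_rel (slot_prog c1 c2) (length ?is + (c2 * L * L * (try_time + 2) + 1)) M xs (slot (set xs)) ?Q"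
    unfolding slot_prog_def
  proof (rule exec_rel_block)
    show "safe ?is M xs" if "good M xs"
      using that assms word_bound_c by (simp add: ready_def) (intro conjI good_upd; simp)
    have "ready (fold det_mem ?is M) xs" using assms by (fastforce simp: ready_def)
    from try_loop_spec[OF this assms(2), of "c2 * L * L"] assms
    show "exec_rel (While_Nonzero 3 (block [Sub 3 3 13] (try_prog c1))) (c2 * L * L * (try_time + 2) + 1)
      (fold det_mem ?is M) xs (slot (set xs)) ?Q"
      by (simp add: slot_def ready_def)
  qed
  then show ?thesis by (rule exec_rel_time) (simp add: slot_time_def)
qed

definition "output_pmf = iter_pmf (\<lambda>_. append_pmf slot) k []"

definition "total_time = 6 * L + 5 + (k * (slot_time + 2) + 1)"

text \<open>Halving a positive number shortens it by one bit, so the loop runs \<open>L\<close>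
  times; quadrupling register 15 alongside yields \<open>4 ^ L\<close>.\<close>

lemma init_loop_spec:
  assumes "M 8 = n" "M 2 = 0" "M 13 = 1" "M 14 = 2" "M 15 = 1"
  shows "exec_rel (While_Nonzero 8 (block [Div 8 8 14, Add 2 2 13, Add 15 15 15, Add 15 15 15] skip))
    (L * (1 + 5) + 1) M xs (return_pmf ())
    (\<lambda>_ M' xs'. xs' = xs \<and> M' 2 = L \<and> M' 15 = 4 ^ L \<and> (\<forall>q. q \<notin> {2, 8, 15} \<longrightarrow> M' q = M q))"
proof -
  let ?is = "[Div 8 8 14, Add 2 2 13, Add 15 15 15, Add 15 15 15]"
  define Inv where "Inv = (\<lambda>j (_::unit) M' xs'. xs' = xs \<and> bits (M' 8) = j \<and> M' 8 \<le> n \<and> M' 2 + j = L \<and>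
     M' 15 * 4 ^ j = 4 ^ L \<and> (\<forall>q. q \<notin> {2, 8, 15} \<longrightarrow> M' q = M q))"
  have "exec_rel (While_Nonzero 8 (block ?is skip)) (L * (1 + 5) + 1) M xs (iter_pmf (\<lambda>_ _. return_pmf ()) L ()) (\<lambda>a'. Inv 0 a')"
  proof (rule exec_rel_for[where Inv = Inv])
    show "Inv L () M xs" using assms by (auto simp: Inv_def L_def)
    show "M 8 = 0" if "Inv 0 a M xs" for a M xs using that by (simp add: Inv_def floorlog_eq_zero_iff)
    fix j and e :: unit and M' xs' assume I: "Inv (Suc j) e M' xs'" and g: "good M' xs'"
    have M': "M' 13 = 1" "M' 14 = 2" using I assms by (auto simp: Inv_def)
    have b: "M' 8 \<noteq> 0" "bits (M' 8 div 2) = j"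
      using I compute_floorlog[of 2 "M' 8"] by (auto simp: Inv_def split: if_splits)
    have n8: "M' 8 div 2 \<le> n" using I by (auto simp: Inv_def intro: div_le_dividend le_trans)
    have p15: "M' 15 * 4 * 4 ^ j = 4 ^ L" using I by (simp add: Inv_def)
    have b15: "M' 15 * 4 \<le> 4 ^ L" 
    proof -
      have "M' 15 * 4 * 1 \<le> M' 15 * 4 * 4 ^ j" by (intro mult_le_mono) auto
      then show ?thesis using p15 by simp
    qed
    have nL: "n \<le> 4 ^ L" "M' 2 + 1 \<le> 4 ^ L"
    proof -
      have "(2::nat) ^ L \<le> 4 ^ L" by (intro power_mono) auto
      then show "n \<le> 4 ^ L" using n_less by linarith
      have "L < 2 ^ L" by (rule less_exp)
      then show "M' 2 + 1 \<le> 4 ^ L" using I \<open>(2::nat) ^ L \<le> 4 ^ L\<close> unfolding Inv_def by linarith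
    qed
    have "exec_rel (block ?is skip) (length ?is + 1) M' xs' (return_pmf ()) (\<lambda>a'. Inv j a')"
    proof (rule exec_rel_block)
      show "safe ?is M' xs'"
        using M' by simp (intro conjI good_upd g word_bound1; insert n8 nL b15; linarith)
      show "exec_rel skip 1 (fold det_mem ?is M') xs' (return_pmf ()) (\<lambda>a'. Inv j a')"
        using M' I b n8 p15 by (intro exec_rel_skip) (auto simp: Inv_def algebra_simps)
    qed
    then show "M' 8 \<noteq> 0 \<and> exec_rel (block ?is skip) 5 M' xs' (return_pmf ()) (\<lambda>a'. Inv j a')"
      using b by (auto intro: exec_rel_time)
  qed
  then show ?thesis unfolding iter_pmf_return
    by (rule exec_rel_conseq) (auto simp: Inv_def)
qed

lemma main_loop_spec:
  assumes "ready M []" "M 1 = k"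
  shows "exec_rel (While_Nonzero 1 (block [Sub 1 1 13] (slot_prog c1 c2))) (k * (1 + (1 + slot_time)) + 1) M []
    output_pmf (\<lambda>ys M' xs'. xs' = ys)"
proof -
  define Inv where "Inv = (\<lambda>j ys M' xs'. xs' = ys \<and> M' 1 = j \<and> ready M' xs' \<and> length xs' + j \<le> k)"
  have "exec_rel (While_Nonzero 1 (block [Sub 1 1 13] (slot_prog c1 c2))) (k * (1 + (1 + slot_time)) + 1) M []
    output_pmf (\<lambda>a'. Inv 0 a')"
    unfolding output_pmf_def
  proof (rule exec_rel_for[where Inv = Inv])
    show "Inv k [] M []" using assms by (simp add: Inv_def)
    show "M 1 = 0" if "Inv 0 a M xs" for a M xs using that by (simp add: Inv_def)
    fix j ys M' xs' assume I: "Inv (Suc j) ys M' xs'" and g: "good M' xs'"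
    have M': "M' 13 = 1" "M' 1 = Suc j" and len: "length xs' < k" and ys: "ys = xs'"
      using I by (auto simp: Inv_def ready_def)
    have "exec_rel (block [Sub 1 1 13] (slot_prog c1 c2)) (length [Sub 1 1 13] + slot_time) M' xs'
      (append_pmf slot ys) (\<lambda>a'. Inv j a')"
    proof (rule exec_rel_block)
      have "M' 1 < 2 ^ B" using g by (simp add: good_def)
      then show "safe [Sub 1 1 13] M' xs'" using M' g by (simp add: good_upd)
      have "ready (fold det_mem [Sub 1 1 13] M') xs'" using I by (fastforce simp: Inv_def ready_def)
      from slot_spec[OF this len]
      show "exec_rel (slot_prog c1 c2) slot_time (fold det_mem [Sub 1 1 13] M') xs' (append_pmf slot ys) (\<lambda>a'. Inv j a')"
        unfolding append_pmf_def ys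
        by (intro exec_rel_map, elim exec_rel_conseq) (use M' I in \<open>auto simp: Inv_def split: option.splits\<close>)
    qed
    then show "M' 1 \<noteq> 0 \<and> exec_rel (block [Sub 1 1 13] (slot_prog c1 c2)) (1 + slot_time) M' xs'
      (append_pmf slot ys) (\<lambda>a'. Inv j a')"
      using M' by simp
  qed
  then show ?thesis by (rule exec_rel_conseq) (auto simp: Inv_def)
qed

lemma good_input: "good (input_mem n k) []"
proof -
  have "(2::nat) ^ L \<le> 4 ^ L" by (intro power_mono) auto
  then have "n \<le> 4 ^ L" using n_less by linarith
  then have "n < 2 ^ B" "k < 2 ^ B" using k_le by (intro word_bound1; linarith)+
  then show ?thesis by (auto simp: good_def input_mem_def)
qed

lemma prime_prog_spec:
  "exec_rel (prime_prog c1 c2) total_time (input_mem n k) [] output_pmf (\<lambda>ys M' xs'. xs' = ys)"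
proof -
  let ?is = "[Const 13 1, Const 14 2, Const 15 1, Copy 8 0]"
  let ?M = "fold det_mem ?is (input_mem n k)"
  have "exec_rel (prime_prog c1 c2) (length ?is + ((L * (1 + 5) + 1) + (k * (1 + (1 + slot_time)) + 1))) (input_mem n k) []
    output_pmf (\<lambda>ys M' xs'. xs' = ys)"
    unfolding prime_prog_def
  proof (rule exec_rel_block)
    have "4 ^ 1 \<le> (4 ^ L :: nat)" using L_pos by (intro power_increasing) auto
    then have c: "v < 2 ^ B" if "v \<le> 2" for v :: nat using that by (intro word_bound1) simp
    have "n < 2 ^ B" using n_less power_increasing[of L B "2::nat"] by (simp add: B_def)
    then show "safe ?is (input_mem n k) []"
      by simp (intro conjI good_upd good_input; simp add: input_mem_def c)
    show "exec_rel (Seq (While_Nonzero 8 (block [Div 8 8 14, Add 2 2 13, Add 15 15 15, Add 15 15 15] skip))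
        (While_Nonzero 1 (block [Sub 1 1 13] (slot_prog c1 c2))))
      ((L * (1 + 5) + 1) + (k * (1 + (1 + slot_time)) + 1)) ?M [] output_pmf (\<lambda>ys M' xs'. xs' = ys)"
    proof (rule exec_rel_Seq_unit[OF init_loop_spec], goal_cases)
      case (6 M' xs')
      then show ?case using main_loop_spec[of M'] by (auto simp: ready_def input_mem_def)
    qed (auto simp: input_mem_def)
  qed
  then show ?thesis by (rule exec_rel_time) (simp add: total_time_def)
qed

theorem run_rel:
  "rel_spmf (\<lambda>s ys. outp s = ys \<and> peak_space s \<le> max_space \<and> bit_ops s \<le> total_time * unit_cost)
     (run (prime_prog c1 c2) n k) (spmf_of_pmf output_pmf)"
proof -
  define s where "s = \<lparr>mem = input_mem n k, outp = [], bit_ops = 0, peak_space = space_in_use (input_mem n k) []\<rparr>"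
  have "mem s = input_mem n k \<and> outp s = [] \<and> peak_space s \<le> max_space \<and> good (input_mem n k) []"
    using good_input good_space by (simp add: s_def)
  then have "rel_spmf (\<lambda>s' a. outp s' = a \<and> good (mem s') (outp s') \<and> peak_space s' \<le> max_space \<and>
      bit_ops s' \<le> bit_ops s + total_time * unit_cost) (exec (prime_prog c1 c2) s) (spmf_of_pmf output_pmf)"
    using prime_prog_spec unfolding exec_rel_def by blast
  then show ?thesis unfolding run_def s_def[symmetric]
    by (rule rel_spmf_mono) (auto simp: s_def)
qed

end

section \<open>Failure probability and uniformity\<close>

lemma measure_bind_pmf_eq:
  fixes p :: "'a pmf" and f :: "'a \<Rightarrow> 'b pmf"
  shows "measure (bind_pmf p f) X = (\<integral>r. measure (f r) X \<partial>measure_pmf p)"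
proof -
  have m: "measure q X = pmf (map_pmf (\<lambda>z. z \<in> X) q) True" for q :: "'b pmf"
    unfolding pmf_map by (rule arg_cong[where f = "measure q"]) auto
  show ?thesis unfolding m by (simp add: map_bind_pmf pmf_bind)
qed

lemma integral_indicator_singleton_pmf:
  "(\<integral>r. indicator {a} r * c \<partial>measure_pmf p) = pmf p a * (c :: real)"
  by (simp add: measure_pmf_single)

lemma pmf_bind_case_option:
  "pmf (bind_pmf p (\<lambda>r. case r of None \<Rightarrow> q | Some x \<Rightarrow> return_pmf (Some x))) y =
     pmf p None * pmf q y + (if y = None then 0 else pmf p y)"
proof -
  let ?f = "\<lambda>r. case r of None \<Rightarrow> q | Some x \<Rightarrow> return_pmf (Some x)"
  have "pmf (?f r) y = indicator {None} r * pmf q y + indicator {y} r * (if y = None then 0 else 1)" for r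
    by (cases r) (auto simp: indicator_def)
  then have "pmf (bind_pmf p ?f) y =
      (\<integral>r. indicator {None} r * pmf q y + indicator {y} r * (if y = None then 0 else 1) \<partial>measure_pmf p)"
    by (simp add: pmf_bind)
  also have "\<dots> = pmf p None * pmf q y + pmf p y * (if y = None then 0 else 1)"
    by (subst Bochner_Integration.integral_add)
      (auto simp: measure_pmf_single intro!: measure_pmf.integrable_const_bound[where B = 1] pmf_le_1 mult_le_one)
  finally show ?thesis by simp
qed

lemma pmf_slot_None: "pmf (slot_pmf D t S) None = pmf (D S) None ^ t"
  by (induction t) (simp_all add: pmf_bind_case_option)

text \<open>The geometric sum \<open>e * (1 + u + ... + u ^ (t - 1))\<close>. What matters is that
  it depends on \<open>S\<close> and \<open>x\<close> only through \<open>e\<close> and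
  \<open>u\<close>.\<close>

primrec slot_prob :: "real \<Rightarrow> real \<Rightarrow> nat \<Rightarrow> real" where
  "slot_prob e u 0 = 0"
| "slot_prob e u (Suc t) = e + u * slot_prob e u t"

lemma pmf_slot_Some:
  "pmf (slot_pmf D t S) (Some x) = slot_prob (pmf (D S) (Some x)) (pmf (D S) None) t"
  by (induction t) (simp_all add: pmf_bind_case_option)

text \<open>A union bound over the tries.\<close>

lemma pmf_slot_Some_le: "pmf (slot_pmf D t S) (Some x) \<le> real t * pmf (D S) (Some x)"
proof (induction t)
  case (Suc t)
  have "pmf (D S) None * pmf (slot_pmf D t S) (Some x) \<le> 1 * pmf (slot_pmf D t S) (Some x)"
    by (intro mult_right_mono pmf_le_1) auto
  then show ?case using Suc by (simp add: pmf_bind_case_option algebra_simps)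
qed simp

lemma pmf_try_Some:
  "pmf (try_pmf U A T S) (Some x) = (if x \<in> A - S then pmf U x * pmf (T x) True else 0)"
proof -
  let ?f = "\<lambda>x. if x \<in> A \<and> x \<notin> S then map_pmf (\<lambda>f. if f then Some x else None) (T x) else return_pmf None"
  have m: "pmf (map_pmf (\<lambda>f. if f then Some x' else None) (T x')) (Some x) = indicator {x} x' * pmf (T x) True" for x'
  proof (cases "x' = x")
    case True
    then have "(\<lambda>f. if f then Some x' else None) -` {Some x} = {True}" by (auto split: if_splits)
    then show ?thesis using True by (simp add: pmf_map measure_pmf_single)
  next
    case False
    then have "(\<lambda>f. if f then Some x' else None) -` {Some x} = {}" by (auto split: if_splits)
    then show ?thesis using False by (simp add: pmf_map)
  qed
  have "pmf (?f x') (Some x) = indicator {x} x' * (if x \<in> A - S then pmf (T x) True else 0)" for x'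
    using m[of x'] by (auto simp: indicator_def)
  then have "pmf (try_pmf U A T S) (Some x) =
      (\<integral>x'. indicator {x} x' * (if x \<in> A - S then pmf (T x) True else 0) \<partial>measure_pmf U)"
    unfolding try_pmf_def pmf_bind by presburger
  also have "\<dots> = pmf U x * (if x \<in> A - S then pmf (T x) True else 0)"
    by (rule integral_indicator_singleton_pmf)
  finally show ?thesis by simp
qed

lemma pmf_try_None:
  assumes "finite A"
  shows "pmf (try_pmf U A T S) None = 1 - (\<Sum>x\<in>A - S. pmf U x * pmf (T x) True)"
proof -
  let ?p = "try_pmf U A T S"
  have "y \<in> insert None (Some ` (A - S))" if "y \<in> set_pmf ?p" for y
    using that by (cases y) (auto simp: set_pmf_iff pmf_try_Some split: if_splits)
  then have "sum (pmf ?p) (insert None (Some ` (A - S))) = 1"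
    using assms by (intro sum_pmf_eq_1) auto
  also have "sum (pmf ?p) (insert None (Some ` (A - S))) = pmf ?p None + (\<Sum>x\<in>A - S. pmf ?p (Some x))"
    using assms by (subst sum.insert) (auto simp: sum.reindex)
  also have "(\<Sum>x\<in>A - S. pmf ?p (Some x)) = (\<Sum>x\<in>A - S. pmf U x * pmf (T x) True)"
    by (intro sum.cong) (auto simp: pmf_try_Some)
  finally show ?thesis by simp
qed

lemma set_pmf_iter_append:
  "zs \<in> set_pmf (iter_pmf (\<lambda>_. append_pmf D) j xs) \<Longrightarrow> \<exists>ys. zs = xs @ ys \<and> length ys \<le> j"
proof (induction j arbitrary: xs)
  case (Suc j)
  then obtain ws where ws: "ws \<in> set_pmf (append_pmf D xs)" "zs \<in> set_pmf (iter_pmf (\<lambda>_. append_pmf D) j ws)"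
    by auto
  then obtain ys where "zs = ws @ ys" "length ys \<le> j" using Suc.IH by blast
  moreover have "ws = xs \<or> (\<exists>x. ws = xs @ [x])"
    using ws(1) by (auto simp: append_pmf_def split: option.splits)
  ultimately show ?case by auto
qed simp

text \<open>The product \<open>g l * g (l + 1) * ...\<close> of \<open>j\<close> factors.\<close>

primrec list_prob :: "(nat \<Rightarrow> real) \<Rightarrow> nat \<Rightarrow> nat \<Rightarrow> real" where
  "list_prob g 0 l = 1"
| "list_prob g (Suc j) l = g l * list_prob g j (Suc l)"

text \<open>A slot appends at most one number, so a list of full length arises in one way only: each
  slot finds exactly the next element. The probability is therefore a product, and its factors see
  only the current length.\<close>

lemma pmf_iter_append:
  assumes g: "\<And>S p. S \<subseteq> P \<Longrightarrow> finite S \<Longrightarrow> p \<in> P - S \<Longrightarrow> pmf (D S) (Some p) = g (card S)"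
  shows "set (xs @ ys) \<subseteq> P \<Longrightarrow> distinct (xs @ ys) \<Longrightarrow>
    pmf (iter_pmf (\<lambda>_. append_pmf D) (length ys) xs) (xs @ ys) = list_prob g (length ys) (length xs)"
proof (induction ys arbitrary: xs)
  case (Cons y ys)
  let ?I = "iter_pmf (\<lambda>_. append_pmf D) (length ys)"
  let ?zs = "xs @ y # ys"
  have "pmf (?I (case r of None \<Rightarrow> xs | Some x \<Rightarrow> xs @ [x])) ?zs =
      indicator {Some y} r * list_prob g (length ys) (Suc (length xs))" for r
  proof (cases "r = Some y")
    case True
    then show ?thesis using Cons.IH[of "xs @ [y]"] Cons.prems by simp
  next
    case False
    have "?zs \<notin> set_pmf (?I (case r of None \<Rightarrow> xs | Some x \<Rightarrow> xs @ [x]))"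
      using False by (auto dest!: set_pmf_iter_append split: option.splits)
    then show ?thesis using False by (simp add: set_pmf_iff)
  qed
  then have "pmf (iter_pmf (\<lambda>_. append_pmf D) (length (y # ys)) xs) ?zs =
      (\<integral>r. indicator {Some y} r * list_prob g (length ys) (Suc (length xs)) \<partial>measure_pmf (D (set xs)))"
    by (simp add: append_pmf_def bind_map_pmf pmf_bind)
  also have "\<dots> = pmf (D (set xs)) (Some y) * list_prob g (length ys) (Suc (length xs))"
    by (rule integral_indicator_singleton_pmf)
  also have "pmf (D (set xs)) (Some y) = g (length xs)"
    using g[of "set xs" y] Cons.prems by (auto simp: distinct_card)
  finally show ?case by simp
qed simp

lemma measure_iter_append_failure:
  fixes D :: "nat set \<Rightarrow> nat option pmf"
  assumes fail: "\<And>S. S \<subseteq> P \<Longrightarrow> finite S \<Longrightarrow> card S < k \<Longrightarrow> measure (D S) (- Some ` (P - S)) \<le> d"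
  shows "set xs \<subseteq> P \<Longrightarrow> distinct xs \<Longrightarrow> length xs + j \<le> k \<Longrightarrow>
    measure (iter_pmf (\<lambda>_. append_pmf D) j xs)
      (- {zs. length zs = length xs + j \<and> distinct zs \<and> set zs \<subseteq> P}) \<le> real j * d"
proof (induction j arbitrary: xs)
  case 0
  then show ?case by (simp add: indicator_def)
next
  case (Suc j)
  let ?I = "iter_pmf (\<lambda>_. append_pmf D) j"
  let ?X = "- {zs. length zs = length xs + Suc j \<and> distinct zs \<and> set zs \<subseteq> P}"
  let ?G = "Some ` (P - set xs)"
  have D: "measure (D (set xs)) (- ?G) \<le> d"
    using Suc.prems by (intro fail) (auto simp: distinct_card)
  then have "0 \<le> d" by (rule order_trans[OF measure_nonneg])
  \<comment> \<open>Either this slot fails, which the indicator pays for, or the list is again a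
    distinct list over \<open>P\<close> and the induction hypothesis applies.\<close>
  have le: "measure (?I (case r of None \<Rightarrow> xs | Some x \<Rightarrow> xs @ [x])) ?X \<le> indicator (- ?G) r + real j * d" for r
  proof (cases "r \<in> ?G")
    case True
    then obtain x where "r = Some x" "x \<in> P - set xs" by auto
    then show ?thesis using Suc.IH[of "xs @ [x]"] Suc.prems by auto
  next
    case False
    have "measure (?I (case r of None \<Rightarrow> xs | Some x \<Rightarrow> xs @ [x])) ?X \<le> 1" by simp
    also have "\<dots> \<le> indicator (- ?G) r + real j * d" using False \<open>0 \<le> d\<close> by simp
    finally show ?thesis .
  qed
  have "measure (iter_pmf (\<lambda>_. append_pmf D) (Suc j) xs) ?X =
      (\<integral>r. measure (?I (case r of None \<Rightarrow> xs | Some x \<Rightarrow> xs @ [x])) ?X \<partial>measure_pmf (D (set xs)))"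
    by (simp add: append_pmf_def bind_map_pmf measure_bind_pmf_eq)
  also have "\<dots> \<le> (\<integral>r. indicator (- ?G) r + real j * d \<partial>measure_pmf (D (set xs)))"
  proof (rule integral_mono[OF _ _ le])
    show "integrable (measure_pmf (D (set xs))) (\<lambda>r. measure (?I (case r of None \<Rightarrow> xs | Some x \<Rightarrow> xs @ [x])) ?X)"
      by (intro measure_pmf.integrable_const_bound[where B = 1]) auto
    show "integrable (measure_pmf (D (set xs))) (\<lambda>r. indicator (- ?G) r + real j * d)"
      by (intro Bochner_Integration.integrable_add measure_pmf.integrable_const_bound[where B = 1]
          measure_pmf.integrable_const) auto
  qed
  also have "\<dots> = measure (D (set xs)) (- ?G) + real j * d"
    by (subst Bochner_Integration.integral_add) (auto intro!: measure_pmf.integrable_const_bound[where B = 1])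
  also note D
  finally show ?case by (simp add: algebra_simps)
qed

section \<open>Error probability of a round\<close>

lemma card_mod_le:
  fixes N Z :: nat
  assumes "0 < N"
  shows "card {r \<in> {..<Z}. R (r mod N)} \<le> (Z div N + 1) * card {a \<in> {..<N}. R a}"
proof -
  have "card {r \<in> {..<Z}. R (r mod N)} \<le> card ({..Z div N} \<times> {a \<in> {..<N}. R a})"
  proof (rule card_inj_on_le[where f = "\<lambda>r. (r div N, r mod N)"])
    show "inj_on (\<lambda>r. (r div N, r mod N)) {r \<in> {..<Z}. R (r mod N)}"
      by (rule inj_onI) (metis div_mult_mod_eq prod.inject)
  qed (use assms in \<open>auto intro: div_le_mono\<close>)
  then show ?thesis by simp
qed

text \<open>At most \<open>N / 2\<close> residues pass, 0 included. A residue has at most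
  \<open>Z div N + 1\<close> preimages, so at most \<open>(Z + N) / 2\<close> words pass, and
  \<open>N \<le> Z / 2\<close> gives the constant \<open>3/4\<close>.\<close>

lemma mr_ok_card:
  assumes "\<not> prime N" "4 \<le> N" "2 * N \<le> Z"
  shows "4 * card {r \<in> {..<Z}. mr_ok N r} \<le> 3 * Z"
proof -
  let ?A = "{a \<in> {1..<N}. mr_pass N a}"
  have sub: "{a \<in> {..<N}. a = 0 \<or> mr_pass N a} \<subseteq> insert 0 ?A" by auto
  have "card {a \<in> {..<N}. a = 0 \<or> mr_pass N a} \<le> card (insert 0 ?A)" by (rule card_mono[OF _ sub]) simp
  also have "\<dots> = Suc (card ?A)" by (subst card_insert_disjoint) auto
  finally have "2 * card {a \<in> {..<N}. a = 0 \<or> mr_pass N a} \<le> N"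
    using mr_pass_card[OF assms(1,2)] assms(2) by linarith
  then have "(Z div N + 1) * (2 * card {a \<in> {..<N}. a = 0 \<or> mr_pass N a}) \<le> (Z div N + 1) * N"
    by (rule mult_le_mono2)
  also have "\<dots> \<le> Z + N" using div_mult_mod_eq[of Z N] by (simp add: algebra_simps)
  finally have "2 * ((Z div N + 1) * card {a \<in> {..<N}. a = 0 \<or> mr_pass N a}) \<le> Z + N"
    by (simp add: algebra_simps)
  moreover have "card {r \<in> {..<Z}. mr_ok N r} \<le> (Z div N + 1) * card {a \<in> {..<N}. a = 0 \<or> mr_pass N a}"
    unfolding mr_ok_def using card_mod_le[of N Z "\<lambda>a. a = 0 \<or> mr_pass N a"] assms by simp
  ultimately have "2 * card {r \<in> {..<Z}. mr_ok N r} \<le> Z + N" by linarith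
  then show ?thesis using assms(3) by linarith
qed

lemma mr_ok_prime: "prime N \<Longrightarrow> mr_ok N r"
  by (cases "r mod N = 0") (auto simp: mr_ok_def mod_eq_0_iff_dvd dvd_mod_iff intro!: mr_pass_prime)

lemma iter_conj_True: "(\<And>r. R r) \<Longrightarrow> iter_pmf (\<lambda>_ f. map_pmf (\<lambda>r. f \<and> R r) U) j f = return_pmf f"
  by (induction j) (simp_all add: map_pmf_const bind_return_pmf)

lemma pmf_iter_conj:
  "pmf (iter_pmf (\<lambda>_ f. map_pmf (\<lambda>r. f \<and> R r) U) j f) True = (if f then measure U {r. R r} ^ j else 0)"
proof (induction j arbitrary: f)
  case (Suc j)
  have "pmf (iter_pmf (\<lambda>_ f. map_pmf (\<lambda>r. f \<and> R r) U) (Suc j) f) True =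
      (\<integral>r. (if f \<and> R r then measure U {r. R r} ^ j else 0) \<partial>measure_pmf U)"
    by (simp add: bind_map_pmf pmf_bind Suc)
  also have "\<dots> = (\<integral>r. indicator {r. R r} r * (if f then measure U {r. R r} ^ j else 0) \<partial>measure_pmf U)"
    by (intro Bochner_Integration.integral_cong) (auto simp: indicator_def)
  also have "\<dots> = measure U {r. R r} * (if f then measure U {r. R r} ^ j else 0)"
    by simp
  finally show ?case by simp
qed simp

section \<open>Success and failure of a slot\<close>

context sampler
begin

definition "primes_in = {p. prime p \<and> n \<le> p \<and> p \<le> n\<^sup>2}"

lemma finite_primes_in [simp]: "finite primes_in"
  by (simp add: primes_in_def)

lemma primes_in_sub: "primes_in \<subseteq> {n..n\<^sup>2}"
  by (auto simp: primes_in_def)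

lemma pmf_coins: "x \<le> n\<^sup>2 \<Longrightarrow> pmf coins x = 1 / (2 * 4 ^ L)"
proof -
  assume "x \<le> n\<^sup>2"
  then have "x < 2 * 4 ^ L" using n2_less by linarith
  moreover have "{..<2 * 4 ^ L :: nat} \<noteq> {}" by (auto simp: lessThan_empty_iff)
  ultimately show ?thesis by (simp add: coins_def)
qed

lemma test_prime: "prime N \<Longrightarrow> test_pmf N = return_pmf True"
  unfolding test_pmf_def by (rule iter_conj_True) (rule mr_ok_prime)

lemma test_composite:
  assumes "\<not> prime N" "n \<le> N" "N \<le> n\<^sup>2"
  shows "pmf (test_pmf N) True \<le> (3 / 4) ^ (c1 * L)"
proof -
  have ne: "{..<2 * 4 ^ L :: nat} \<noteq> {}" by (auto simp: lessThan_empty_iff)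
  have "4 * card {r \<in> {..<2 * 4 ^ L}. mr_ok N r} \<le> 3 * (2 * 4 ^ L)"
    using assms n16 n2_less by (intro mr_ok_card) auto
  then have "real (4 * card {r \<in> {..<2 * 4 ^ L}. mr_ok N r}) \<le> real (3 * (2 * 4 ^ L))"
    by (subst of_nat_le_iff)
  then have c: "4 * real (card {r \<in> {..<2 * 4 ^ L}. mr_ok N r}) \<le> 3 * (2 * 4 ^ L)" by simp
  have "measure coins {r. mr_ok N r} = real (card {r \<in> {..<2 * 4 ^ L}. mr_ok N r}) / (2 * 4 ^ L)"
    using ne by (simp add: coins_def measure_pmf_of_set Int_def)
  also have "\<dots> \<le> 3 / 4" using c by (simp add: divide_simps)
  finally show ?thesis unfolding test_pmf_def pmf_iter_conj by (auto intro: power_mono)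
qed

text \<open>The sum runs over all nonprimes of the range, whatever has been output: a set
  \<open>S\<close> of primes excludes none of them, which is why this is a constant.\<close>

definition "false_pos = (\<Sum>x\<in>{n..n\<^sup>2} - primes_in. pmf coins x * pmf (test_pmf x) True)"

lemma cand_prime: "p \<in> primes_in - S \<Longrightarrow> pmf (cand_pmf S) (Some p) = 1 / (2 * 4 ^ L)"
  unfolding cand_pmf_def pmf_try_Some
  using primes_in_sub by (auto simp: test_prime pmf_coins primes_in_def)

lemma cand_None:
  assumes "S \<subseteq> primes_in"
  shows "pmf (cand_pmf S) None = 1 - false_pos - real (card primes_in - card S) / (2 * 4 ^ L)"
proof -
  have split: "{n..n\<^sup>2} - S = ({n..n\<^sup>2} - primes_in) \<union> (primes_in - S)" using assms primes_in_sub by auto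
  have "(\<Sum>x\<in>{n..n\<^sup>2} - S. pmf coins x * pmf (test_pmf x) True) =
      false_pos + (\<Sum>x\<in>primes_in - S. pmf coins x * pmf (test_pmf x) True)"
    unfolding split false_pos_def by (rule sum.union_disjoint) auto
  also have "(\<Sum>x\<in>primes_in - S. pmf coins x * pmf (test_pmf x) True) = (\<Sum>x\<in>primes_in - S. 1 / (2 * 4 ^ L))"
    by (intro sum.cong) (auto simp: test_prime pmf_coins primes_in_def)
  also have "\<dots> = real (card primes_in - card S) / (2 * 4 ^ L)"
    using assms finite_subset[OF assms] by (simp add: card_Diff_subset)
  finally show ?thesis unfolding cand_pmf_def by (simp add: pmf_try_None)
qed

text \<open>
  Primes are never rejected, so the probability that a slot yields a given new prime depends only
  on the number of primes seen so far.
\<close>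

definition "slot_weight l = slot_prob (1 / (2 * 4 ^ L))
  (1 - false_pos - real (card primes_in - l) / (2 * 4 ^ L)) (c2 * L * L)"

lemma slot_uniform:
  "S \<subseteq> primes_in \<Longrightarrow> p \<in> primes_in - S \<Longrightarrow> pmf (slot S) (Some p) = slot_weight (card S)"
  unfolding slot_def pmf_slot_Some slot_weight_def by (simp add: cand_prime cand_None)

text \<open>The constant is \<open>64 * 8\<close>: at least \<open>n\<^sup>2 / (64 L)\<close> primes
  remain after fewer than \<open>k \<le> n\<close> finds, and the sampling range
  \<open>2 * 4 ^ L\<close> is at most \<open>8 n\<^sup>2\<close>.\<close>

lemma primes_left:
  assumes "l < k"
  shows "1 / (512 * real L) \<le> real (card primes_in - l) / (2 * 4 ^ L)"
proof -
  define lg where "lg = log 2 (real n)"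
  have lg: "1 \<le> lg" unfolding lg_def using n16 by (simp add: le_log_iff)
  have "lg \<le> real L"
    unfolding lg_def L_def floorlog_def using n16 by (simp add: le_nat_floor) linarith
  then have 1: "real (n\<^sup>2) / (64 * real L) \<le> real (n\<^sup>2) / (64 * lg)"
    using lg by (intro divide_left_mono) auto
  have 2: "real n + real (n\<^sup>2) / (64 * lg) \<le> real (card primes_in) + 1"
    unfolding lg_def primes_in_def using primes_between_lower[OF n16] .
  have "real l + 1 \<le> real n" using assms k_le by simp
  then have 3: "real (n\<^sup>2) / (64 * real L) \<le> real (card primes_in) - real l" using 1 2 by linarith
  also have "\<dots> \<le> real (card primes_in - l)" by linarith
  finally have 4: "real (n\<^sup>2) / (64 * real L) \<le> real (card primes_in - l)" .
  have "(2::nat) ^ L = 2 * 2 ^ (L - 1)" using L_pos by (metis Suc_diff_1 less_le_trans power_Suc zero_less_numeral)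
  then have "2 ^ L \<le> 2 * n" using le_n by simp
  then have "(2 ^ L)\<^sup>2 \<le> (2 * n)\<^sup>2" by (rule power_mono) simp
  moreover have "(2 ^ L)\<^sup>2 = (4::nat) ^ L" 
    unfolding power2_eq_square power_mult_distrib[symmetric] by simp
  ultimately have "4 ^ L \<le> 4 * n\<^sup>2" by (simp add: power_mult_distrib)
  then have "real (4 ^ L) \<le> real (4 * n\<^sup>2)" by (subst of_nat_le_iff)
  then have 5: "2 * 4 ^ L \<le> 8 * real (n\<^sup>2)" by simp
  have L0: "0 < real L" using L_pos by simp
  have "1 / (512 * real L) * (2 * 4 ^ L) \<le> 1 / (512 * real L) * (8 * real (n\<^sup>2))"
    using 5 L0 by (intro mult_left_mono) auto
  also have "\<dots> = real (n\<^sup>2) / (64 * real L)" by (simp add: field_simps)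
  also note 4
  finally show ?thesis by (simp add: pos_le_divide_eq)
qed

text \<open>The first term bounds the event that no try accepts anything, the second that some try
  accepts a composite.\<close>

definition "slot_failure = (1 - 1 / (512 * real L)) ^ (c2 * L * L) + real (c2 * L * L) * (3 / 4) ^ (c1 * L)"

lemma false_pos_le: "0 \<le> false_pos" "(\<Sum>x\<in>{n..n\<^sup>2} - primes_in. pmf (cand_pmf S) (Some x)) \<le> (3 / 4) ^ (c1 * L)"
proof -
  show "0 \<le> false_pos" unfolding false_pos_def by (intro sum_nonneg mult_nonneg_nonneg) auto
  have "(\<Sum>x\<in>{n..n\<^sup>2} - primes_in. pmf (cand_pmf S) (Some x)) \<le>
      (\<Sum>x\<in>{n..n\<^sup>2} - primes_in. pmf coins x * (3 / 4) ^ (c1 * L))"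
  proof (rule sum_mono)
    fix x assume x: "x \<in> {n..n\<^sup>2} - primes_in"
    then have "pmf (test_pmf x) True \<le> (3 / 4) ^ (c1 * L)"
      by (intro test_composite) (auto simp: primes_in_def)
    then show "pmf (cand_pmf S) (Some x) \<le> pmf coins x * (3 / 4) ^ (c1 * L)"
      unfolding cand_pmf_def pmf_try_Some by (auto intro: mult_left_mono)
  qed
  also have "\<dots> = sum (pmf coins) ({n..n\<^sup>2} - primes_in) * (3 / 4) ^ (c1 * L)" by (simp add: sum_distrib_right)
  also have "\<dots> \<le> 1 * (3 / 4) ^ (c1 * L)"
  proof (rule mult_right_mono)
    have "sum (pmf coins) ({n..n\<^sup>2} - primes_in) = measure coins ({n..n\<^sup>2} - primes_in)"
      by (simp add: measure_measure_pmf_finite)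
    then show "sum (pmf coins) ({n..n\<^sup>2} - primes_in) \<le> 1" by simp
  qed simp
  finally show "(\<Sum>x\<in>{n..n\<^sup>2} - primes_in. pmf (cand_pmf S) (Some x)) \<le> (3 / 4) ^ (c1 * L)" by simp
qed

lemma slot_failure_bound:
  assumes S: "S \<subseteq> primes_in" "card S < k"
  shows "measure (slot S) (- Some ` (primes_in - S)) \<le> slot_failure"
proof -
  let ?C = "{n..n\<^sup>2} - primes_in"
  have supp: "set_pmf (slot S) \<subseteq> insert None (Some ` ({n..n\<^sup>2} - S))"
  proof
    fix y assume y: "y \<in> set_pmf (slot S)"
    show "y \<in> insert None (Some ` ({n..n\<^sup>2} - S))"
    proof (cases y)
      case (Some x)
      have "0 < pmf (slot S) (Some x)" using y Some by (simp add: set_pmf_iff pmf_nonneg less_le)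
      also have "\<dots> \<le> real (c2 * L * L) * pmf (cand_pmf S) (Some x)"
        unfolding slot_def by (rule pmf_slot_Some_le)
      finally have "pmf (cand_pmf S) (Some x) \<noteq> 0" by auto
      then show ?thesis using Some by (auto simp: cand_pmf_def pmf_try_Some split: if_splits)
    qed simp
  qed
  have "measure (slot S) (- Some ` (primes_in - S)) = measure (slot S) (- Some ` (primes_in - S) \<inter> set_pmf (slot S))"
    by (rule measure_Int_set_pmf[symmetric])
  also have "\<dots> \<le> measure (slot S) (insert None (Some ` ?C))"
    using supp S(1) by (intro measure_pmf.finite_measure_mono) auto
  also have "\<dots> = sum (pmf (slot S)) (insert None (Some ` ?C))"
    by (rule measure_measure_pmf_finite) simp
  also have "\<dots> = pmf (slot S) None + (\<Sum>x\<in>?C. pmf (slot S) (Some x))"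
    by (subst sum.insert) (auto simp: sum.reindex)
  also have "(\<Sum>x\<in>?C. pmf (slot S) (Some x)) \<le> (\<Sum>x\<in>?C. real (c2 * L * L) * pmf (cand_pmf S) (Some x))"
    unfolding slot_def by (intro sum_mono pmf_slot_Some_le)
  also have "\<dots> = real (c2 * L * L) * (\<Sum>x\<in>?C. pmf (cand_pmf S) (Some x))"
    by (rule sum_distrib_left[symmetric])
  also have "\<dots> \<le> real (c2 * L * L) * (3 / 4) ^ (c1 * L)"
    by (intro mult_left_mono false_pos_le) simp
  also have "pmf (slot S) None \<le> (1 - 1 / (512 * real L)) ^ (c2 * L * L)"
    unfolding slot_def pmf_slot_None
  proof (rule power_mono)
    show "pmf (cand_pmf S) None \<le> 1 - 1 / (512 * real L)"
      using cand_None[OF S(1)] primes_left[OF S(2)] false_pos_le(1) by linarith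
  qed simp
  finally show ?thesis by (simp add: slot_failure_def)
qed

section \<open>From lists of primes to sets of primes\<close>

definition "good_lists = {zs. length zs = k \<and> distinct zs \<and> set zs \<subseteq> primes_in}"

lemma output_failure: "measure output_pmf (- good_lists) \<le> real k * slot_failure"
  using measure_iter_append_failure[of primes_in k slot slot_failure "[]" k] slot_failure_bound
  by (simp add: output_pmf_def good_lists_def)

lemma output_uniform: "zs \<in> good_lists \<Longrightarrow> pmf output_pmf zs = list_prob slot_weight k 0"
  using pmf_iter_append[of primes_in slot slot_weight "[]" zs] slot_uniform
  by (auto simp: output_pmf_def good_lists_def)

lemma finite_good_lists: "finite good_lists"
  unfolding good_lists_def
  by (rule finite_subset[OF _ finite_lists_length_eq[of primes_in k]]) auto

lemma good_lists_iff: "zs \<in> good_lists \<longleftrightarrow> length zs = k \<and> set zs \<in> prime_sets n k"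
  unfolding good_lists_def prime_sets_def primes_in_def mem_Collect_eq
  using distinct_card[of zs] card_distinct[of zs] by metis

lemma good_lists_fiber:
  assumes "A \<in> prime_sets n k"
  shows "{zs \<in> good_lists. set zs = A} = permutations_of_set A"
proof (intro equalityI subsetI)
  fix zs assume "zs \<in> permutations_of_set A"
  then have "set zs = A" "length zs = card A" by (auto simp: permutations_of_set_def distinct_card)
  then show "zs \<in> {zs \<in> good_lists. set zs = A}" using assms by (simp add: good_lists_iff prime_sets_def)
qed (auto simp: good_lists_def permutations_of_set_def)

lemma finite_prime_sets: "finite (prime_sets n k)"
  unfolding prime_sets_def
  by (rule finite_subset[of _ "Pow primes_in"]) (auto simp: primes_in_def)

lemma card_good_lists: "card good_lists = card (prime_sets n k) * fact k"
proof -
  have "good_lists = (\<Union>A\<in>prime_sets n k. permutations_of_set A)"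
    using good_lists_fiber good_lists_iff by blast
  also have "card \<dots> = (\<Sum>A\<in>prime_sets n k. card (permutations_of_set A))"
  proof (rule card_UN_disjoint)
    show "\<forall>A\<in>prime_sets n k. \<forall>A'\<in>prime_sets n k. A \<noteq> A' \<longrightarrow> permutations_of_set A \<inter> permutations_of_set A' = {}"
      by (auto simp: permutations_of_set_def)
  qed (use finite_prime_sets in auto)
  also have "\<dots> = (\<Sum>A\<in>prime_sets n k. fact k)"
  proof (rule sum.cong)
    fix A assume "A \<in> prime_sets n k"
    then have "finite A" "card A = k" using k_pos by (auto simp: prime_sets_def intro: card_ge_0_finite)
    then show "card (permutations_of_set A) = fact k" by simp
  qed simp
  finally show ?thesis by simp
qed

text \<open>All good lists have the same weight, and each set of \<open>k\<close> primes is listed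
  by exactly \<open>fact k\<close> of them.\<close>

lemma cond_output_uniform:
  assumes pos: "measure output_pmf good_lists \<noteq> 0"
  shows "map_spmf set (cond_spmf (spmf_of_pmf output_pmf) good_lists) = spmf_of_set (prime_sets n k)"
proof (rule spmf_eqI)
  fix A
  define h where "h = list_prob slot_weight k 0"
  let ?q = "cond_spmf (spmf_of_pmf output_pmf) good_lists"
  have tot: "measure output_pmf good_lists = real (card good_lists) * h"
    using finite_good_lists output_uniform by (simp add: measure_measure_pmf_finite h_def)
  have q: "spmf ?q zs = (if zs \<in> good_lists then h / (real (card good_lists) * h) else 0)" for zs
    using output_uniform tot by (simp add: h_def)
  have "spmf (map_spmf set ?q) A = measure (measure_spmf ?q) (set -` {A})" by (rule spmf_map)
  also have "\<dots> = measure (measure_spmf ?q) {zs \<in> good_lists. set zs = A}"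
    by (rule measure_spmf.finite_measure_eq_AE) (auto simp: AE_measure_spmf_iff)
  also have "\<dots> = (\<Sum>zs\<in>{zs \<in> good_lists. set zs = A}. spmf ?q zs)"
    using finite_good_lists by (subst measure_spmf.finite_measure_eq_sum_singleton) (auto simp: spmf_conv_measure_spmf)
  also have "\<dots> = real (card {zs \<in> good_lists. set zs = A}) * (h / (real (card good_lists) * h))"
    by (simp add: q del: spmf_cond_spmf)
  also have "\<dots> = indicator (prime_sets n k) A / card (prime_sets n k)"
  proof (cases "A \<in> prime_sets n k")
    case True
    then have "finite A" "card A = k" using k_pos by (auto simp: prime_sets_def intro: card_ge_0_finite)
    then have "card {zs \<in> good_lists. set zs = A} = fact k" using good_lists_fiber[OF True] by simp
    \<comment> \<open>By \<open>pos\<close>, neither the common weight \<open>h\<close> nor the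
      number of prime sets is 0, so both cancel.\<close>
    then show ?thesis using True tot pos by (simp add: card_good_lists)
  next
    case False
    then have "card {zs \<in> good_lists. set zs = A} = 0" by (intro card_eq_0_iff[THEN iffD2]) (auto simp: good_lists_iff)
    then show ?thesis using False by simp
  qed
  finally show "spmf (map_spmf set ?q) A = spmf (spmf_of_set (prime_sets n k)) A"
    by (simp add: spmf_of_set)
qed

lemma map_outp_run: "map_spmf outp (run (prime_prog c1 c2) n k) = spmf_of_pmf output_pmf"
proof -
  have "rel_spmf (\<lambda>s ys. outp s = ys) (run (prime_prog c1 c2) n k) (spmf_of_pmf output_pmf)"
    using run_rel by (rule rel_spmf_mono) simp
  then have "rel_spmf (=) (map_spmf outp (run (prime_prog c1 c2) n k)) (spmf_of_pmf output_pmf)"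
    by (simp add: spmf_rel_map1)
  then show ?thesis by (simp only: spmf_rel_eq)
qed

lemma run_lossless: "lossless_spmf (run (prime_prog c1 c2) n k)"
proof -
  have "lossless_spmf (map_spmf outp (run (prime_prog c1 c2) n k))" unfolding map_outp_run by simp
  then show ?thesis by simp
qed

lemma run_bounds:
  assumes "s \<in> set_spmf (run (prime_prog c1 c2) n k)"
  shows "peak_space s \<le> max_space" "bit_ops s \<le> total_time * unit_cost"
proof -
  obtain pq where "\<And>s ys. (s, ys) \<in> set_spmf pq \<Longrightarrow> outp s = ys \<and> peak_space s \<le> max_space \<and> bit_ops s \<le> total_time * unit_cost"
    and "run (prime_prog c1 c2) n k = map_spmf fst pq"
    using run_rel by (rule rel_spmfE) blast
  then have "peak_space s \<le> max_space \<and> bit_ops s \<le> total_time * unit_cost" using assms by fastforce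
  then show "peak_space s \<le> max_space" "bit_ops s \<le> total_time * unit_cost" by auto
qed

lemma success_vimage: "success n k = outp -` good_lists"
  by (simp add: success_def good_lists_iff set_eq_iff)

lemma run_failure:
  "measure (measure_spmf (run (prime_prog c1 c2) n k)) (- success n k) \<le> real k * slot_failure"
proof -
  have "measure (measure_spmf (run (prime_prog c1 c2) n k)) (- success n k) =
      measure (measure_spmf (map_spmf outp (run (prime_prog c1 c2) n k))) (- good_lists)"
    unfolding measure_map_spmf success_vimage by (simp add: vimage_Compl)
  then show ?thesis unfolding map_outp_run using output_failure by simp
qed

lemma run_uniform:
  assumes "measure (measure_spmf (run (prime_prog c1 c2) n k)) (- success n k) < 1"
  shows "map_spmf (\<lambda>s. set (outp s)) (cond_spmf (run (prime_prog c1 c2) n k) (success n k)) = spmf_of_set (prime_sets n k)"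
proof -
  let ?r = "run (prime_prog c1 c2) n k"
  have "measure (measure_spmf ?r) (- success n k) = measure output_pmf (- good_lists)"
    using map_outp_run measure_map_spmf[of outp ?r "- good_lists"] by (simp add: success_vimage vimage_Compl)
  also have "\<dots> = 1 - measure output_pmf good_lists"
    using measure_pmf.prob_compl[of good_lists output_pmf] by (simp add: Compl_eq_Diff_UNIV)
  finally have "measure output_pmf good_lists \<noteq> 0" using assms by simp
  then have "map_spmf set (cond_spmf (map_spmf outp ?r) good_lists) = spmf_of_set (prime_sets n k)"
    unfolding map_outp_run by (rule cond_output_uniform)
  then show ?thesis by (simp add: success_vimage spmf.map_comp o_def)
qed

section \<open>Resource bounds and the choice of constants\<close>

lemma L_le: "real L \<le> 2 * log 2 (real n)"
proof -
  have "1 \<le> log 2 (real n)" using n16 by (simp add: le_log_iff)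
  moreover have "real L \<le> log 2 (real n) + 1"
    using n16 calculation unfolding L_def floorlog_def by (simp add: of_nat_floor)
  ultimately show ?thesis by linarith
qed

lemma max_space_le: "max_space \<le> k * ((16 * (9 + c1 + c2) + 6) * L)"
proof -
  have L1: "1 \<le> L" using L_pos by simp
  have "n\<^sup>2 < 2 ^ (2 * L)" using n2_less by (simp add: power_mult)
  then have "bits (n\<^sup>2) \<le> 2 * L" by (intro floorlog_leI) auto
  then have "k * (2 * bits (n\<^sup>2) + 2) \<le> k * (6 * L)" using L1 by (intro mult_le_mono2) linarith
  moreover have "c1 \<le> c1 * L" "c2 \<le> c2 * L" using L1 by auto
  then have "16 * (4 + B) \<le> 16 * ((9 + c1 + c2) * L)"
    using L1 unfolding B_def distrib_right by (intro mult_le_mono2) linarith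
  moreover have "1 * (16 * ((9 + c1 + c2) * L)) \<le> k * (16 * ((9 + c1 + c2) * L))"
    using k_pos by (rule mult_le_mono1)
  ultimately show ?thesis unfolding max_space_def by (simp add: algebra_simps)
qed

text \<open>The exponent 6: a slot makes \<open>O(L\<^sup>2)\<close> tries with \<open>O(L)\<close>
  rounds of \<open>O(L)\<close> instructions, and an instruction costs \<open>O(L\<^sup>2)\<close>
  bit operations.\<close>

lemma total_cost_le:
  "total_time * unit_cost \<le> k * (((c2 * (108 * c1 + 48) + 18) * (6 + c1 + c2)\<^sup>2) * L ^ 6)"
proof -
  have L1: "1 \<le> L" using L_pos by simp
  have L2: "L \<le> L\<^sup>2" "1 \<le> L\<^sup>2" "1 \<le> L ^ 4" "L \<le> L ^ 4"
    using L1 self_le_power[of L 2] self_le_power[of L 4] by auto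
  have "round_time + 2 \<le> 108 * L" using L1 by (simp add: round_time_def)
  then have "c1 * L * (round_time + 2) \<le> c1 * L * (108 * L)" by (rule mult_le_mono2)
  then have "test_time \<le> 108 * c1 * L\<^sup>2 + 4" by (simp add: test_time_def power2_eq_square algebra_simps)
  moreover have "12 * L + 30 + 2 + 4 \<le> 48 * L\<^sup>2" using L2 by linarith
  ultimately have "try_time + 2 \<le> 108 * c1 * L\<^sup>2 + 48 * L\<^sup>2" unfolding try_time_def by linarith
  also have "\<dots> = (108 * c1 + 48) * L\<^sup>2" by (simp add: algebra_simps)
  finally have "c2 * L * L * (try_time + 2) \<le> c2 * L * L * ((108 * c1 + 48) * L\<^sup>2)" by (rule mult_le_mono2)
  also have "\<dots> = c2 * (108 * c1 + 48) * L ^ 4"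
    by (simp add: power2_eq_square power4_eq_xxxx)
  finally have "slot_time + 2 \<le> c2 * (108 * c1 + 48) * L ^ 4 + 6 * L ^ 4" unfolding slot_time_def using L2 by linarith
  then have "k * (slot_time + 2) \<le> k * (c2 * (108 * c1 + 48) * L ^ 4 + 6 * L ^ 4)" by (rule mult_le_mono2)
  moreover have "6 * L + 5 + 1 \<le> 12 * L ^ 4" using L2 by linarith
  moreover have "1 * (12 * L ^ 4) \<le> k * (12 * L ^ 4)" using k_pos by (rule mult_le_mono1)
  ultimately have "total_time \<le> k * (c2 * (108 * c1 + 48) * L ^ 4 + 6 * L ^ 4) + k * (12 * L ^ 4)"
    unfolding total_time_def by linarith
  also have "\<dots> = k * ((c2 * (108 * c1 + 48) + 18) * L ^ 4)" by (simp add: algebra_simps)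
  finally have 1: "total_time \<le> k * ((c2 * (108 * c1 + 48) + 18) * L ^ 4)" .
  have "c1 \<le> c1 * L" "c2 \<le> c2 * L" using L1 by auto
  then have "1 + B \<le> (6 + c1 + c2) * L" using L1 unfolding B_def distrib_right by linarith
  then have "unit_cost \<le> ((6 + c1 + c2) * L) * ((6 + c1 + c2) * L)"
    unfolding unit_cost_def by (intro mult_le_mono)
  also have "\<dots> = (6 + c1 + c2)\<^sup>2 * L\<^sup>2" by (simp add: power2_eq_square)
  finally have "total_time * unit_cost \<le> k * ((c2 * (108 * c1 + 48) + 18) * L ^ 4) * ((6 + c1 + c2)\<^sup>2 * L\<^sup>2)"
    using 1 by (intro mult_le_mono)
  also have "\<dots> = k * (((c2 * (108 * c1 + 48) + 18) * (6 + c1 + c2)\<^sup>2) * (L ^ 4 * L\<^sup>2))" by (simp only: mult_ac)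
  also have "L ^ 4 * L\<^sup>2 = L ^ 6" by (simp flip: power_add)
  finally show ?thesis .
qed

text \<open>With \<open>E = (e + 2) * L\<close>, both terms of \<open>slot_failure\<close> are at
  most \<open>(1/2) ^ E\<close>. For the first, \<open>512 (e + 2) L\<^sup>2\<close> tries give
  \<open>exp (- E)\<close>. For the second, three rounds halve the error, as
  \<open>(3/4) ^ 3 \<le> 1/2\<close>; a share \<open>c2 + 2\<close> of \<open>c1 / 3\<close> pays
  for the number of tries and \<open>e + 2\<close> is left. The 2 in \<open>e + 2\<close> absorbs
  the factors \<open>k\<close> and 2, each at most \<open>2 ^ L\<close>.\<close>

lemma slot_failure_le:
  assumes c2: "c2 = 512 * (e + 2)" and c1: "c1 = 3 * (c2 + e + 4)"
  shows "real k * slot_failure \<le> 1 / real n ^ e"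
proof -
  define E where "E = (e + 2) * L"
  have L0: "0 < real L" and L1: "1 \<le> L" using L_pos by auto
  have "1 - 1 / (512 * real L) \<le> exp (- (1 / (512 * real L)))"
    using exp_ge_add_one_self[of "- (1 / (512 * real L))"] by simp
  then have "(1 - 1 / (512 * real L)) ^ (c2 * L * L) \<le> exp (- (1 / (512 * real L))) ^ (c2 * L * L)"
    using L_pos by (intro power_mono) (auto simp: divide_simps)
  also have "\<dots> = exp (real (c2 * L * L) * - (1 / (512 * real L)))" by (rule exp_of_nat_mult[symmetric])
  also have "real (c2 * L * L) * - (1 / (512 * real L)) = real E * - 1"
    using L0 by (simp add: c2 E_def field_simps)
  also have "exp (real E * - 1) = exp (- 1) ^ E" by (rule exp_of_nat_mult)
  also have "\<dots> \<le> (1 / 2) ^ E"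
  proof (rule power_mono)
    have "2 \<le> exp (1::real)" using exp_ge_add_one_self[of 1] by simp
    then show "exp (- 1) \<le> (1 / 2 :: real)" by (simp add: exp_minus divide_simps)
  qed simp
  finally have 1: "(1 - 1 / (512 * real L)) ^ (c2 * L * L) \<le> (1 / 2) ^ E" .
  have "(3 / 4 :: real) ^ (c1 * L) = ((3 / 4) ^ 3) ^ ((c2 + e + 4) * L)"
    unfolding c1 by (simp only: power_mult[symmetric] mult.assoc)
  also have "\<dots> \<le> (1 / 2) ^ ((c2 + e + 4) * L)" by (intro power_mono) (auto simp: power3_eq_cube)
  finally have "real (c2 * L * L) * (3 / 4) ^ (c1 * L) \<le> real (c2 * L * L) * (1 / 2) ^ ((c2 + e + 4) * L)"
    by (intro mult_left_mono) auto
  also have "real (c2 * L * L) \<le> 2 ^ ((c2 + 2) * L)"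
  proof -
    have "c2 \<le> 2 ^ (c2 * L)" 
    proof -
      have "c2 * 1 \<le> c2 * L" using L1 by (rule mult_le_mono2)
      then show ?thesis using less_exp[of "c2 * L"] by linarith
    qed
    moreover have "L \<le> 2 ^ L" using less_exp[of L] by simp
    ultimately have "c2 * L * L \<le> 2 ^ (c2 * L) * 2 ^ L * 2 ^ L" by (intro mult_le_mono)
    also have "\<dots> = 2 ^ ((c2 + 2) * L)" by (simp add: power_add[symmetric] algebra_simps)
    finally have "real (c2 * L * L) \<le> real (2 ^ ((c2 + 2) * L))" by (subst of_nat_le_iff)
    then show ?thesis by simp
  qed
  then have "real (c2 * L * L) * (1 / 2) ^ ((c2 + e + 4) * L) \<le> 2 ^ ((c2 + 2) * L) * (1 / 2) ^ ((c2 + e + 4) * L)"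
    by (intro mult_right_mono) auto
  also have "(c2 + e + 4) * L = (c2 + 2) * L + E" by (simp add: E_def algebra_simps)
  also have "2 ^ ((c2 + 2) * L) * (1 / 2) ^ ((c2 + 2) * L + E) = (1 / 2 :: real) ^ E"
    by (simp add: power_add power_one_over)
  finally have 2: "real (c2 * L * L) * (3 / 4) ^ (c1 * L) \<le> (1 / 2) ^ E" by simp
  have nL: "real n \<le> 2 ^ L" using n_less by (metis less_imp_le of_nat_le_iff of_nat_numeral of_nat_power)
  have "real k * slot_failure \<le> 2 ^ L * (2 * (1 / 2) ^ E)"
  proof (rule mult_mono)
    show "real k \<le> 2 ^ L" using k_le nL by linarith
    show "slot_failure \<le> 2 * (1 / 2) ^ E" using 1 2 unfolding slot_failure_def by linarith
    show "0 \<le> slot_failure" unfolding slot_failure_def using L_pos by (intro add_nonneg_nonneg) (auto simp: divide_simps)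
  qed simp
  also have "\<dots> \<le> 2 ^ L * (2 ^ L * (1 / 2) ^ E)"
    using L1 self_le_power[of "2::real" L] by (intro mult_left_mono mult_right_mono) auto
  also have "\<dots> = (1 / 2) ^ (e * L)"
    by (simp add: E_def power_add power_one_over algebra_simps)
  also have "\<dots> = 1 / (2 ^ L) ^ e" by (simp add: power_one_over power_mult[symmetric] mult.commute)
  also have "\<dots> \<le> 1 / real n ^ e"
    using nL n16 by (intro divide_left_mono power_mono mult_pos_pos) auto
  finally show ?thesis .
qed

end

theorem theorem3p14:
  fixes c :: real
  assumes "c > 0"
  shows "\<exists>(P :: prog) (C :: real) (d :: nat). \<forall>n k :: nat. 16 \<le> n \<and> 1 \<le> k \<and> k \<le> n \<longrightarrow>
    lossless_spmf (run P n k) \<and>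
    measure (measure_spmf (run P n k)) (- success n k) \<le> 1 / real n powr c \<and>
    map_spmf (\<lambda>s. set (outp s)) (cond_spmf (run P n k) (success n k)) =
      spmf_of_set (prime_sets n k) \<and>
    (\<forall>s \<in> set_spmf (run P n k).
      real (bit_ops s) \<le> C * real k * log 2 (real n) ^ d \<and>
      real (peak_space s) \<le> C * real k * log 2 (real n))"
proof -
  define e where "e = nat \<lceil>c\<rceil>"
  have e: "c \<le> real e" unfolding e_def by (rule real_nat_ceiling_ge)
  define c2 where "c2 = 512 * (e + 2)"
  define c1 where "c1 = 3 * (c2 + e + 4)"
  define Ct where "Ct = (c2 * (108 * c1 + 48) + 18) * (6 + c1 + c2)\<^sup>2"
  define Cs where "Cs = 16 * (9 + c1 + c2) + 6"
  \<comment> \<open>From \<open>L \<le> 2 * log 2 n\<close>: the factor 64 is \<open>2 ^ 6\<close>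
    for time, and 2 is for space.\<close>
  define C where "C = 64 * real Ct + 2 * real Cs"
  show ?thesis
  proof (intro exI[of _ "prime_prog c1 c2"] exI[of _ C] exI[of _ 6] allI impI conjI ballI)
    fix n k :: nat assume nk: "16 \<le> n \<and> 1 \<le> k \<and> k \<le> n"
    then interpret sampler n k c1 c2 by unfold_locales auto
    define lg where "lg = log 2 (real n)"
    have lg: "real L \<le> 2 * lg" unfolding lg_def by (rule L_le)
    then have lg0: "0 \<le> lg" by linarith
    show "lossless_spmf (run (prime_prog c1 c2) n k)" by (rule run_lossless)
    have "measure (measure_spmf (run (prime_prog c1 c2) n k)) (- success n k) \<le> 1 / real n ^ e"
      using run_failure slot_failure_le[OF c2_def c1_def] by (rule order_trans)
    also have "1 / real n ^ e \<le> 1 / real n powr c"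
    proof (rule divide_left_mono)
      have "real n powr c \<le> real n powr real e" using e nk by (intro powr_mono) auto
      then show "real n powr c \<le> real n ^ e" using nk by (simp add: powr_realpow)
    qed (use nk in auto)
    finally show f: "measure (measure_spmf (run (prime_prog c1 c2) n k)) (- success n k) \<le> 1 / real n powr c" .
    \<comment> \<open>Since \<open>c > 0\<close>, the failure bound is strictly below 1, so
      conditioning on success is meaningful.\<close>
    have "1 < real n powr c" using nk assms by (intro gr_one_powr) auto
    then have "1 / real n powr c < 1 / 1" 
      using nk by (intro divide_strict_left_mono) auto
    then show "map_spmf (\<lambda>s. set (outp s)) (cond_spmf (run (prime_prog c1 c2) n k) (success n k)) =
      spmf_of_set (prime_sets n k)"
      using f by (intro run_uniform) linarith
    fix s assume s: "s \<in> set_spmf (run (prime_prog c1 c2) n k)"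
    have "bit_ops s \<le> k * (Ct * L ^ 6)"
      using run_bounds(2)[OF s] total_cost_le unfolding Ct_def by (rule order_trans)
    then have "real (bit_ops s) \<le> real (k * (Ct * L ^ 6))" by (subst of_nat_le_iff)
    also have "\<dots> = real k * (real Ct * real L ^ 6)" by simp
    also have "\<dots> \<le> real k * (real Ct * (2 * lg) ^ 6)"
      using lg by (intro mult_left_mono power_mono) auto
    also have "\<dots> = (64 * real Ct) * (real k * lg ^ 6)" by (simp add: power_mult_distrib)
    also have "\<dots> \<le> C * (real k * lg ^ 6)"
      using lg0 by (intro mult_right_mono) (auto simp: C_def)
    finally show "real (bit_ops s) \<le> C * real k * log 2 (real n) ^ 6" by (simp add: lg_def mult.assoc)
    have "peak_space s \<le> k * (Cs * L)"
      using run_bounds(1)[OF s] max_space_le unfolding Cs_def by (rule order_trans)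
    then have "real (peak_space s) \<le> real (k * (Cs * L))" by (subst of_nat_le_iff)
    also have "\<dots> = real k * (real Cs * real L)" by simp
    also have "\<dots> \<le> real k * (real Cs * (2 * lg))"
      using lg by (intro mult_left_mono) auto
    also have "\<dots> = (2 * real Cs) * (real k * lg)" by simp
    also have "\<dots> \<le> C * (real k * lg)"
      using lg0 by (intro mult_right_mono) (auto simp: C_def)
    finally show "real (peak_space s) \<le> C * real k * log 2 (real n)" by (simp add: lg_def mult.assoc)
  qed
qed

end
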